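(* Let $A$ be a $d\times n$ integer matrix. The gap function $\mathrm{gap}_A:\mathbb{R}^n\to\mathbb{R}$, $c\mapsto\mathrm{gap}(A,c)$, is a piecewise linear function (on the set of $c$ for which the integer programs are bounded). It is linear on each cone of the gap fan of $A$, but in general it is not linear on the cones of the Gröbner fan of $A$ (that is, there exist matrices $A$ for which $\mathrm{gap}_A$ is not linear on some cone of the Gröbner fan of $A$).
   Context: For $c\in\mathbb{R}^n$ and $b\in\mathbb{Z}^d$, the integer program is: minimize $c\cdot u$ subject to $Au=b$, $u\ge0$, $u\in\mathbb{Z}^n$; its linear relaxation is obtained by replacing $u\in\mathbb{Z}^n$ by $u\in\mathbb{R}^n$. $\mathrm{gap}(A,c)$ is the maximum of (optimal value of the integer program) $-$ (optimal value of its relaxation), over all $b$ for which the integer program is feasible and bounded. A vector $u\in\mathbb{N}^n$ is non-optimal if it is not an optimal solution of the integer program with $b=Au$; $M(A,c)\subseteq\mathbb{R}[x_1,\dots,x_n]$ is the ideal generated by all monomials $x^u$ with $u$ non-optimal. The Gröbner fan of $A$ is the coarsest polyhedral fan in $\mathbb{R}^n$ on which the map $c\mapsto M(A,c)$ is constant (on relative interiors of cones). For $\tau=\{i_1,\dots,i_r\}\subseteq\{1,\dots,n\}$ and $u\in\mathbb{N}^n$ with $u_j=0$ for $j\notin\tau$, $I(u,\tau)=\langle x_{i_1}^{u_{i_1}+1},\dots,x_{i_r}^{u_{i_r}+1}\rangle$. The irreducible components of a monomial ideal are the ideals of this form in its unique irredundant decomposition as an intersection of such ideals. The gap fan of $A$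 is the refinement of the Gröbner fan of $A$ obtained by subdividing each maximal cone $\mathcal{K}$ as follows. Let $M$ be the monomial ideal with $M(A,c)=M$ for all $c$ in the interior of $\mathcal{K}$. For each irreducible component $I(u,\tau)$ of $M$ let $v_{u,\tau}\in\mathbb{R}^n$ be the optimal solution of the linear program: maximize $c\cdot u-c\cdot v$ subject to $Av=Au$ and $v_i\ge0$ for all $i\in\tau$ (other coordinates of $v$ unrestricted in sign); this solution does not change as $c$ varies in (the interior of) $\mathcal{K}$. Let $\mathcal{G}=\{(c,t)\in\mathbb{R}^{n+1}: c\in\mathcal{K},\ c\cdot(u-v_{u,\tau})\le t\text{ for every irreducible component }I(u,\tau)\text{ of }M\}$. Then $\mathcal{K}$ is subdivided into the images, under $(c,t)\mapsto c$, of the faces of the lower envelope of $\mathcal{G}$ (the set of points $(c,t)\in\mathcal{G}$ with $t$ minimal for the given $c$). *)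

theory Defs
  imports "HOL-Analysis.Analysis" "HOL-Library.Poly_Mapping"
begin

section \<open>Integer programs and their gap\<close>

definition int_vec :: "nat ^ 'n \<Rightarrow> int ^ 'n" where
  "int_vec u = (\<chi> i. int (u $ i))"

definition real_vec :: "int ^ 'n \<Rightarrow> real ^ 'n" where
  "real_vec u = (\<chi> i. real_of_int (u $ i))"

definition ip_feasible :: "int ^ 'n ^ 'd \<Rightarrow> int ^ 'd \<Rightarrow> (int ^ 'n) set" where
  "ip_feasible A b = {u. A *v u = b \<and> (\<forall>i. 0 \<le> u $ i)}"

definition lp_feasible :: "int ^ 'n ^ 'd \<Rightarrow> int ^ 'd \<Rightarrow> (real ^ 'n) set" where
  "lp_feasible A b =
    {u. map_matrix real_of_int A *v u = real_vec b \<and> (\<forall>i. 0 \<le> u $ i)}"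

definition ip_bounded :: "int ^ 'n ^ 'd \<Rightarrow> real ^ 'n \<Rightarrow> int ^ 'd \<Rightarrow> bool" where
  "ip_bounded A c b \<longleftrightarrow> bdd_below ((\<lambda>u. c \<bullet> real_vec u) ` ip_feasible A b)"

definition ip_value :: "int ^ 'n ^ 'd \<Rightarrow> real ^ 'n \<Rightarrow> int ^ 'd \<Rightarrow> real" where
  "ip_value A c b = (INF u\<in>ip_feasible A b. c \<bullet> real_vec u)"

definition lp_value :: "int ^ 'n ^ 'd \<Rightarrow> real ^ 'n \<Rightarrow> int ^ 'd \<Rightarrow> real" where
  "lp_value A c b = (INF u\<in>lp_feasible A b. c \<bullet> u)"

text \<open>The gap is a maximum, not merely a supremum, hence \<open>GREATEST\<close>.\<close>

definition gap :: "int ^ 'n ^ 'd \<Rightarrow> real ^ 'n \<Rightarrow> real" where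
  "gap A c = (GREATEST g. \<exists>b. ip_feasible A b \<noteq> {} \<and> ip_bounded A c b
                             \<and> g = ip_value A c b - lp_value A c b)"

definition bounded_costs :: "int ^ 'n ^ 'd \<Rightarrow> (real ^ 'n) set" where
  "bounded_costs A = {c. \<forall>b. ip_bounded A c b}"


section \<open>Monomial ideals\<close>

text \<open>The polynomial ring over the reals, with one variable for each index in \<open>'n\<close>, is the
  monoid algebra of the additive monoid of exponent vectors.\<close>

type_synonym 'n mpoly = "(nat ^ 'n) \<Rightarrow>\<^sub>0 real"

definition monomial :: "nat ^ 'n \<Rightarrow> 'n mpoly" where
  "monomial u = Poly_Mapping.single u 1"

text \<open>Ideals are the submodules of the ring regarded as a module over itself.\<close>

definition ideal_generated_by :: "'a::comm_ring_1 set \<Rightarrow> 'a set" where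
  "ideal_generated_by S = module.span (*) S"

definition non_optimal :: "int ^ 'n ^ 'd \<Rightarrow> real ^ 'n \<Rightarrow> nat ^ 'n \<Rightarrow> bool" where
  "non_optimal A c u \<longleftrightarrow>
    \<not> (\<forall>w\<in>ip_feasible A (A *v int_vec u). c \<bullet> real_vec (int_vec u) \<le> c \<bullet> real_vec w)"

definition non_optimal_ideal :: "int ^ 'n ^ 'd \<Rightarrow> real ^ 'n \<Rightarrow> 'n mpoly set" where
  "non_optimal_ideal A c = ideal_generated_by {monomial u |u. non_optimal A c u}"

definition irreducible_ideal :: "nat ^ 'n \<Rightarrow> 'n set \<Rightarrow> 'n mpoly set" where
  "irreducible_ideal u \<tau> = ideal_generated_by {monomial (axis i (u $ i + 1)) |i. i \<in> \<tau>}"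

text \<open>An ideal \<open>I(u, \<tau>)\<close> is represented by the pair \<open>(u, \<tau>)\<close>, which it determines
  because \<open>u\<close> vanishes outside \<open>\<tau>\<close>.\<close>

definition irredundant_decomposition ::
    "'n mpoly set \<Rightarrow> ((nat ^ 'n) \<times> 'n set) set \<Rightarrow> bool" where
  "irredundant_decomposition M D \<longleftrightarrow>
     finite D \<and>
     (\<forall>(u, \<tau>)\<in>D. \<forall>j. j \<notin> \<tau> \<longrightarrow> u $ j = 0) \<and>
     (\<Inter>(u, \<tau>)\<in>D. irreducible_ideal u \<tau>) = M \<and>
     (\<forall>D'. D' \<subset> D \<longrightarrow> (\<Inter>(u, \<tau>)\<in>D'. irreducible_ideal u \<tau>) \<noteq> M)"

definition irreducible_components :: "'n mpoly set \<Rightarrow> ((nat ^ 'n) \<times> 'n set) set" where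
  "irreducible_components M = (THE D. irredundant_decomposition M D)"


section \<open>The Groebner fan\<close>

text \<open>The cones of a fan need not be pointed: every cone of a Groebner fan contains the row
  space of the matrix.\<close>

definition polyhedral_fan :: "'a::euclidean_space set set \<Rightarrow> bool" where
  "polyhedral_fan F \<longleftrightarrow>
     finite F \<and>
     (\<forall>C\<in>F. convex_cone C \<and> polyhedron C) \<and>
     (\<forall>C\<in>F. \<forall>D. D face_of C \<and> D \<noteq> {} \<longrightarrow> D \<in> F) \<and>
     (\<forall>C\<in>F. \<forall>D\<in>F. (C \<inter> D) face_of C \<and> (C \<inter> D) face_of D)"

text \<open>A cost vector outside \<open>bounded_costs A\<close> has no optimal solutions at all, so its ideal is the
  unit ideal. The region of such cost vectors is not a union of closed cones and in general has no
  coarsest subdivision; the fan is therefore a subdivision of \<open>bounded_costs A\<close>, which is the whole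
  space exactly if no nonzero nonnegative vector lies in the kernel of \<open>A\<close>.\<close>

definition ideal_constant_fan :: "int ^ 'n ^ 'd \<Rightarrow> (real ^ 'n) set set \<Rightarrow> bool" where
  "ideal_constant_fan A F \<longleftrightarrow>
     polyhedral_fan F \<and> \<Union>F = bounded_costs A \<and>
     (\<forall>C\<in>F. \<forall>c\<in>rel_interior C. \<forall>c'\<in>rel_interior C.
        non_optimal_ideal A c = non_optimal_ideal A c')"

definition groebner_fan :: "int ^ 'n ^ 'd \<Rightarrow> (real ^ 'n) set set" where
  "groebner_fan A = (THE F. ideal_constant_fan A F \<and>
     (\<forall>F'. ideal_constant_fan A F' \<longrightarrow> (\<forall>C'\<in>F'. \<exists>C\<in>F. C' \<subseteq> C)))"

definition maximal_cones :: "'a set set \<Rightarrow> 'a set set" where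
  "maximal_cones F = {K \<in> F. \<forall>K'\<in>F. K \<subseteq> K' \<longrightarrow> K' = K}"


section \<open>The gap fan\<close>

definition cone_ideal :: "int ^ 'n ^ 'd \<Rightarrow> (real ^ 'n) set \<Rightarrow> 'n mpoly set" where
  "cone_ideal A K = (THE M. \<forall>c\<in>interior K. non_optimal_ideal A c = M)"

definition relaxed_feasible ::
    "int ^ 'n ^ 'd \<Rightarrow> nat ^ 'n \<Rightarrow> 'n set \<Rightarrow> (real ^ 'n) set" where
  "relaxed_feasible A u \<tau> =
    {v. map_matrix real_of_int A *v v = map_matrix real_of_int A *v real_vec (int_vec u)
        \<and> (\<forall>i\<in>\<tau>. 0 \<le> v $ i)}"

definition relaxed_optimal ::
    "int ^ 'n ^ 'd \<Rightarrow> real ^ 'n \<Rightarrow> nat ^ 'n \<Rightarrow> 'n set \<Rightarrow> real ^ 'n \<Rightarrow> bool" where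
  "relaxed_optimal A c u \<tau> v \<longleftrightarrow>
     v \<in> relaxed_feasible A u \<tau> \<and>
     (\<forall>w\<in>relaxed_feasible A u \<tau>.
        c \<bullet> real_vec (int_vec u) - c \<bullet> w \<le> c \<bullet> real_vec (int_vec u) - c \<bullet> v)"

definition relaxed_solution ::
    "int ^ 'n ^ 'd \<Rightarrow> (real ^ 'n) set \<Rightarrow> nat ^ 'n \<Rightarrow> 'n set \<Rightarrow> real ^ 'n" where
  "relaxed_solution A K u \<tau> = (THE v. \<forall>c\<in>interior K. relaxed_optimal A c u \<tau> v)"

definition gap_polyhedron ::
    "int ^ 'n ^ 'd \<Rightarrow> (real ^ 'n) set \<Rightarrow> ((real ^ 'n) \<times> real) set" where
  "gap_polyhedron A K =
    {(c, t). c \<in> K \<and>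
       (\<forall>(u, \<tau>)\<in>irreducible_components (cone_ideal A K).
          c \<bullet> (real_vec (int_vec u) - relaxed_solution A K u \<tau>) \<le> t)}"

definition lower_envelope :: "('a \<times> real) set \<Rightarrow> ('a \<times> real) set" where
  "lower_envelope G = {(c, t) \<in> G. \<forall>s. (c, s) \<in> G \<longrightarrow> t \<le> s}"

text \<open>The faces of the lower envelope are the nonempty faces of the polyhedron that are
  contained in it; \<open>face_of\<close> also admits the empty face.\<close>

definition gap_fan :: "int ^ 'n ^ 'd \<Rightarrow> (real ^ 'n) set set" where
  "gap_fan A = {fst ` F |F K. K \<in> maximal_cones (groebner_fan A) \<and>
     F face_of gap_polyhedron A K \<and> F \<noteq> {} \<and> F \<subseteq> lower_envelope (gap_polyhedron A K)}"


section \<open>Piecewise linearity\<close>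

definition is_linear_on :: "'a::real_vector set \<Rightarrow> ('a \<Rightarrow> real) \<Rightarrow> bool" where
  "is_linear_on S f \<longleftrightarrow> (\<exists>L. linear L \<and> (\<forall>x\<in>S. f x = L x))"

text \<open>The pieces are closed, so a piecewise linear function is continuous.\<close>

definition piecewise_linear_on :: "'a::euclidean_space set \<Rightarrow> ('a \<Rightarrow> real) \<Rightarrow> bool" where
  "piecewise_linear_on S f \<longleftrightarrow>
     (\<exists>P. finite P \<and> (\<forall>C\<in>P. polyhedron C \<and> is_linear_on C f) \<and> \<Union>P = S)"

end

theory Submission
  imports Defs
begin

text \<open>
  Call an exponent vector optimal for \<open>c\<close> if it solves the integer program of its own fiber. The
  optimal vectors are exactly the exponents outside \<open>non_optimal_ideal A c\<close>, so everything that
  depends on this ideal can be read off from the downward closed set \<open>optimal_vectors A c\<close>.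

  The cones of the Groebner fan are the sets \<open>groebner_cone A c\<close>, for bounded \<open>c\<close>, of all cost
  vectors \<open>c'\<close> for which every vector that is optimal for \<open>c\<close> stays optimal (\<open>groebner_fan_eq\<close>). A Hilbert basis of the
  monoid of pairs in a common fiber shows that each of them is polyhedral and that there are finitely
  many. The face relations hold because a vector that is optimal for a proper convex combination of
  two costs is optimal for both, if these have a common optimal vector in its fiber. Every bounded cost vector lies in a
  cone with nonempty interior (\<open>in_full_dimensional_cone\<close>).

  The irreducible components \<open>(u, \<tau>)\<close> of the ideal correspond to the maximal boxes
  \<open>{v. \<forall>i\<in>\<tau>. v\<^sub>i \<le> u\<^sub>i}\<close> inside the set of optimal vectors. On a cone \<open>K\<close> with nonempty interior the
  gap is the maximum of the finitely many linear forms \<open>c \<bullet> (u - v)\<close>, where \<open>v\<close> solves the relaxed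
  program of the component \<open>(u, \<tau>)\<close> (\<open>gap_eq_Max\<close>). An optimal integer vector in the box of
  \<open>(u, \<tau>)\<close> together with any point of its linear relaxation can be shifted to \<open>u\<close> and a point of the
  relaxed program, which gives the upper bound. Conversely, \<open>u\<close> and \<open>v\<close> shifted far in the directions
  outside \<open>\<tau>\<close> are optimal for an integer program and its relaxation, so every form is attained.

  A maximum of finitely many linear forms is linear on the pieces where a fixed form is largest, and
  on a face of the lower envelope of the epigraph the form that is active at a relative interior
  point is active everywhere. For the matrix with the single row (3, 1, 2) and the costs \<open>(0, a, b)\<close>
  near \<open>(0, 1, 1)\<close> two forms compete and the gap is \<open>max a b\<close>.
\<close>

section \<open>Finiteness of minimal elements and Hilbert bases\<close>

text \<open>Dickson's lemma, for elements with finitely many natural coordinates. By induction on the set of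
  coordinates: a finite set \<open>G\<close> that dominates \<open>S\<close> in the old coordinates fails in the new one only
  on elements whose new coordinate is below some bound, and these form finitely many level sets.\<close>

lemma dickson:
  fixes F :: "('a \<Rightarrow> nat) set" and S :: "'a set"
  assumes "finite F"
  shows "\<exists>G. finite G \<and> G \<subseteq> S \<and> (\<forall>x\<in>S. \<exists>g\<in>G. \<forall>f\<in>F. f g \<le> f x)"
  using assms
proof (induction F arbitrary: S)
  case empty
  show ?case
  proof (cases "S = {}")
    case False
    then obtain s where "s \<in> S" by blast
    then show ?thesis by (intro exI[of _ "{s}"]) auto
  qed auto
next
  case (insert f F)
  obtain G where G: "finite G" "G \<subseteq> S" "\<forall>x\<in>S. \<exists>g\<in>G. \<forall>f\<in>F. f g \<le> f x"
    using insert.IH[of S] by (elim exE conjE)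
  define M where "M = (\<Sum>g\<in>G. f g)"
  have M: "f g \<le> M" if "g \<in> G" for g
    unfolding M_def using member_le_sum[of g G f] G(1) that by simp
  define dom where "dom m H \<longleftrightarrow> finite H \<and> H \<subseteq> {x\<in>S. f x = m} \<and>
      (\<forall>x\<in>{x\<in>S. f x = m}. \<exists>g\<in>H. \<forall>f\<in>F. f g \<le> f x)" for m H
  have "\<forall>m. \<exists>H. dom m H"
    unfolding dom_def by (intro allI insert.IH)
  then obtain H where "\<And>m. dom m (H m)" by metis
  then have H: "finite (H m)" "H m \<subseteq> {x\<in>S. f x = m}"
    "\<forall>x\<in>{x\<in>S. f x = m}. \<exists>g\<in>H m. \<forall>f\<in>F. f g \<le> f x" for m
    unfolding dom_def by blast+
  show ?case
  proof (intro exI[of _ "G \<union> (\<Union>m<M. H m)"] conjI ballI)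
    show "finite (G \<union> (\<Union>m<M. H m))" using G H by auto
    show "G \<union> (\<Union>m<M. H m) \<subseteq> S" using G H by blast
    fix x assume x: "x \<in> S"
    show "\<exists>g\<in>G \<union> (\<Union>m<M. H m). \<forall>f\<in>insert f F. f g \<le> f x"
    proof (cases "f x < M")
      case True
      then obtain g where g: "g \<in> H (f x)" "\<forall>f\<in>F. f g \<le> f x" using H(3)[of "f x"] x by blast
      then have "f g = f x" using H(2) by blast
      then show ?thesis using g True by (intro bexI[of _ g]) auto
    next
      case False
      obtain g where g: "g \<in> G" "\<forall>f\<in>F. f g \<le> f x" using G(3) x by blast
      then have "f g \<le> f x" using M False by (meson le_trans linorder_not_le)
      then show ?thesis using g by auto
    qed
  qed
qed

text \<open>The basis consists of the minimal nonzero elements; splitting one off lowers the sum of the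
  coordinates. Generation is expressed as an induction rule, since it serves to transfer an
  additive inequality from the basis to the whole monoid.\<close>

lemma hilbert_basis:
  fixes F :: "('a::comm_monoid_add \<Rightarrow> nat) set" and S :: "'a set"
  assumes fin: "finite F"
    and add: "\<And>f x y. f \<in> F \<Longrightarrow> f (x + y) = f x + f y"
    and zero: "\<And>x. \<forall>f\<in>F. f x = 0 \<Longrightarrow> x = 0"
    and diff: "\<And>x y. x \<in> S \<Longrightarrow> y \<in> S \<Longrightarrow> \<forall>f\<in>F. f x \<le> f y \<Longrightarrow> \<exists>z\<in>S. y = z + x"
  shows "\<exists>H. finite H \<and> H \<subseteq> S \<and>
    (\<forall>P. P 0 \<longrightarrow> (\<forall>x\<in>S. \<forall>h\<in>H. P x \<longrightarrow> P (x + h)) \<longrightarrow> (\<forall>x\<in>S. P x))"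
proof -
  obtain H where H: "finite H" "H \<subseteq> S - {0}"
    "\<forall>x\<in>S - {0}. \<exists>h\<in>H. \<forall>f\<in>F. f h \<le> f x"
    using dickson[OF fin, of "S - {0}"] by (elim exE conjE)
  have "P x" if P: "P 0" "\<forall>x\<in>S. \<forall>h\<in>H. P x \<longrightarrow> P (x + h)" and x: "x \<in> S" for P x
    using x
  proof (induction "\<Sum>f\<in>F. f x" arbitrary: x rule: less_induct)
    case less
    show ?case
    proof (cases "x = 0")
      case False
      then obtain h where h: "h \<in> H" "\<forall>f\<in>F. f h \<le> f x" using H(3) less.prems by blast
      have "h \<in> S" "h \<noteq> 0" using h H by auto
      obtain z where z: "z \<in> S" "x = z + h" using diff[OF \<open>h \<in> S\<close> less.prems h(2)] by blast
      obtain f0 where "f0 \<in> F" "f0 h \<noteq> 0" using zero \<open>h \<noteq> 0\<close> by blast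
      then have "(\<Sum>f\<in>F. f h) > 0" using sum_pos2[OF fin, of f0 "\<lambda>f. f h"] by simp
      moreover have "(\<Sum>f\<in>F. f x) = (\<Sum>f\<in>F. f z) + (\<Sum>f\<in>F. f h)"
        unfolding z(2) sum.distrib[symmetric] by (intro sum.cong) (auto simp: add)
      ultimately have "(\<Sum>f\<in>F. f z) < (\<Sum>f\<in>F. f x)" by simp
      then have "P z" using less.hyps z(1) by blast
      then show ?thesis using P(2) z h by blast
    qed (use P in simp)
  qed
  then show ?thesis using H by (intro exI[of _ H]) blast
qed

section \<open>Rational approximation of feasible points\<close>

abbreviation rvec :: "nat ^ 'n \<Rightarrow> real ^ 'n" where
  "rvec u \<equiv> real_vec (int_vec u)"

abbreviation rmat :: "int ^ 'n ^ 'd \<Rightarrow> real ^ 'n ^ 'd" where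
  "rmat A \<equiv> map_matrix real_of_int A"

abbreviation fiber :: "int ^ 'n ^ 'd \<Rightarrow> nat ^ 'n \<Rightarrow> int ^ 'd" where
  "fiber A u \<equiv> A *v int_vec u"

lemma rvec_nth [simp]: "rvec u $ i = real (u $ i)"
  by (simp add: real_vec_def int_vec_def)

lemma rvec_add: "rvec (u + w) = rvec u + rvec w"
  by (simp add: vec_eq_iff)

lemma rvec_scale: "rvec (k *s u) = real k *\<^sub>R rvec u"
  by (simp add: vec_eq_iff)

lemma fiber_add: "fiber A (u + w) = fiber A u + fiber A w"
  by (simp add: vec_eq_iff matrix_vector_mult_def int_vec_def algebra_simps sum.distrib)

lemma fiber_scale: "fiber A (k *s u) = int k *s fiber A u"
  by (simp add: vec_eq_iff matrix_vector_mult_def int_vec_def sum_distrib_left algebra_simps)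

lemma real_vec_mult: "rmat A *v real_vec x = real_vec (A *v x)"
  by (simp add: vec_eq_iff matrix_vector_mult_def real_vec_def map_matrix_def)

lemma real_vec_inj: "real_vec x = real_vec y \<longleftrightarrow> x = y"
  by (simp add: vec_eq_iff real_vec_def)

lemma fiber_eq_iff: "fiber A u = fiber A w \<longleftrightarrow> rmat A *v rvec u = rmat A *v rvec w"
  by (simp add: real_vec_mult real_vec_inj)

lemma int_vec_surj:
  assumes "\<forall>i. 0 \<le> x $ i"
  obtains u where "x = int_vec u"
proof
  show "x = int_vec (\<chi> i. nat (x $ i))" using assms by (simp add: vec_eq_iff int_vec_def)
qed

lemma ip_feasible_eq: "ip_feasible A b = int_vec ` {w. fiber A w = b}"
proof -
  have "x \<in> int_vec ` {w. fiber A w = b}" if "x \<in> ip_feasible A b" for x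
    using that int_vec_surj[of x] unfolding ip_feasible_def by blast
  then show ?thesis by (auto simp: ip_feasible_def int_vec_def)
qed

text \<open>Dirichlet's theorem provides a multiple \<open>q x\<close> that is close to a natural vector \<open>p\<close>. If the error is
  small compared to the entries of \<open>A\<close>, then \<open>A p - q b\<close> is an integer vector with entries below 1
  in absolute value, so the approximating points \<open>p / q\<close> satisfy the equations exactly. This
  replaces all use of vertices of rational polyhedra below.\<close>

lemma rational_approximation:
  fixes A :: "int ^ 'n ^ 'd" and x :: "real ^ 'n"
  assumes x: "rmat A *v x = real_vec b" "\<forall>i. 0 \<le> x $ i" and e: "0 < e"
  obtains q p where "0 < q" "fiber A p = int q *s b" "\<forall>i. \<bar>real q * x $ i - real (p $ i)\<bar> < e"
proof -
  obtain f :: "nat \<Rightarrow> 'n" where f: "bij_betw f {0..<card (UNIV::'n set)} UNIV"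
    using ex_bij_betw_nat_finite[of "UNIV::'n set"] by auto
  define R where "R = (\<Sum>i\<in>UNIV. \<Sum>j\<in>UNIV. \<bar>real_of_int (A $ i $ j)\<bar>) + 1"
  have R1: "(\<Sum>j\<in>UNIV. \<bar>real_of_int (A $ i $ j)\<bar>) \<le> R" for i
  proof -
    have "(\<Sum>j\<in>UNIV. \<bar>real_of_int (A $ i $ j)\<bar>) \<le> (\<Sum>i\<in>UNIV. \<Sum>j\<in>UNIV. \<bar>real_of_int (A $ i $ j)\<bar>)"
      by (rule member_le_sum) (auto intro: sum_nonneg)
    then show ?thesis unfolding R_def by simp
  qed
  have R0: "R \<ge> 1" unfolding R_def by (auto intro!: sum_nonneg)
  obtain N :: nat where N: "real N > max R (1 / e)" using reals_Archimedean2 by blast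
  have N0: "N > 0" "real N > 1" using N R0 by (auto intro: gr0I)
  obtain q p where q: "0 < q" and p:
    "\<And>i. i < card (UNIV::'n set) \<Longrightarrow> \<bar>of_int q * x $ f i - of_int (p i)\<bar> < 1 / N"
    using Dirichlet_approx_simult[OF N0(1), of "card (UNIV::'n set)" "\<lambda>i. x $ f i"] by metis
  define y :: "int ^ 'n" where "y = (\<chi> j. p (the_inv_into {0..<card (UNIV::'n set)} f j))"
  have y: "\<bar>of_int q * x $ j - of_int (y $ j)\<bar> < 1 / N" for j
  proof -
    have "f (the_inv_into {0..<card (UNIV::'n set)} f j) = j"
      by (rule f_the_inv_into_f_bij_betw[OF f]) simp
    moreover have "the_inv_into {0..<card (UNIV::'n set)} f j < card (UNIV::'n set)"
      using the_inv_into_into[of f "{0..<card (UNIV::'n set)}" j "{0..<card (UNIV::'n set)}"] f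
      unfolding bij_betw_def by auto
    ultimately show ?thesis
      using p[of "the_inv_into {0..<card (UNIV::'n set)} f j"] unfolding y_def by simp
  qed
  have Ne: "1 / N < e" using N e N0 by (simp add: field_simps)
  have N1: "1 / N < 1" using N0 by simp
  have "0 \<le> y $ j" for j
  proof -
    have "real_of_int q * x $ j \<ge> 0" using x(2) q by simp
    then have "real_of_int (y $ j) > -1" using y[of j] N1 by linarith
    then show ?thesis by linarith
  qed
  then obtain u where u: "y = int_vec u" using int_vec_surj by blast
  \<comment> \<open>An integer vector whose entries are smaller than 1 in absolute value is zero.\<close>
  have "A *v y = q *s b"
  proof (simp add: vec_eq_iff, intro allI)
    fix i
    have eq: "(\<Sum>j\<in>UNIV. real_of_int (A $ i $ j) * x $ j) = real_of_int (b $ i)"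
      using x(1) by (simp add: vec_eq_iff matrix_vector_mult_def map_matrix_def real_vec_def)
    have "real_of_int (q * b $ i - (A *v y) $ i)
        = (\<Sum>j\<in>UNIV. real_of_int (A $ i $ j) * (of_int q * x $ j - of_int (y $ j)))"
      by (simp add: eq[symmetric] matrix_vector_mult_def right_diff_distrib sum_subtractf
          sum_distrib_left mult.left_commute)
    also have "\<bar>\<dots>\<bar> \<le> (\<Sum>j\<in>UNIV. \<bar>real_of_int (A $ i $ j)\<bar> * (1 / N))"
      unfolding abs_mult[symmetric]
      by (intro order_trans[OF sum_abs] sum_mono)
        (simp only: abs_mult, rule mult_left_mono[OF less_imp_le[OF y] abs_ge_zero])
    also have "\<dots> \<le> R * (1 / N)"
      unfolding sum_distrib_right[symmetric] by (intro mult_right_mono R1) simp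
    also have "\<dots> < 1" using N N0 by (simp add: field_simps)
    finally have "\<bar>q * b $ i - (A *v y) $ i\<bar> < 1" by linarith
    then show "(A *v y) $ i = q * b $ i" by linarith
  qed
  then have "fiber A u = int (nat q) *s b" using q u by simp
  moreover have "\<bar>real (nat q) * x $ i - real (u $ i)\<bar> < e" for i
    using y[of i] Ne q u by (simp add: int_vec_def)
  ultimately show ?thesis using that[of "nat q" u] q by auto
qed

section \<open>Monomial ideals and their irreducible components\<close>

text \<open>The monomial ideals are the sets \<open>supported_in U\<close> with \<open>U\<close> closed under increasing exponents, which
  turns statements about these ideals into statements about sets of exponent vectors.\<close>

definition supported_in :: "(nat ^ 'n) set \<Rightarrow> 'n mpoly set" where
  "supported_in U = {p. Poly_Mapping.keys p \<subseteq> U}"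

lemma supported_in_inj [simp]: "supported_in U = supported_in V \<longleftrightarrow> U = V"
proof -
  have "u \<in> U \<longleftrightarrow> Poly_Mapping.single u 1 \<in> supported_in U" for u and U :: "(nat ^ 'n) set"
    by (simp add: supported_in_def)
  then show ?thesis by blast
qed

lemma ideal_generated_by_monomials:
  fixes S :: "(nat ^ 'n) set"
  shows "ideal_generated_by (monomial ` S) = supported_in {v. \<exists>s\<in>S. s \<le> v}"
proof -
  interpret module "(*) :: 'n mpoly \<Rightarrow> 'n mpoly \<Rightarrow> 'n mpoly"
    by unfold_locales (auto simp: algebra_simps)
  have up: "a + b \<in> {v. \<exists>s\<in>S. s \<le> v}" if "b \<in> {v. \<exists>s\<in>S. s \<le> v}" for a b
    using that by (auto simp: less_eq_vec_def intro!: trans_le_add2)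
  have "subspace (supported_in {v. \<exists>s\<in>S. s \<le> v})"
  proof (rule subspaceI)
    fix p q :: "'n mpoly" assume "p \<in> supported_in {v. \<exists>s\<in>S. s \<le> v}" "q \<in> supported_in {v. \<exists>s\<in>S. s \<le> v}"
    then show "p + q \<in> supported_in {v. \<exists>s\<in>S. s \<le> v}"
      unfolding supported_in_def using keys_add[of p q] by blast
  next
    fix p q :: "'n mpoly" assume q: "q \<in> supported_in {v. \<exists>s\<in>S. s \<le> v}"
    show "p * q \<in> supported_in {v. \<exists>s\<in>S. s \<le> v}"
      unfolding supported_in_def
    proof (rule CollectI, rule subsetI)
      fix k assume "k \<in> Poly_Mapping.keys (p * q)"
      then obtain a b where "k = a + b" "b \<in> Poly_Mapping.keys q" using keys_mult[of p q] by auto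
      moreover from this have "b \<in> {v. \<exists>s\<in>S. s \<le> v}" using q unfolding supported_in_def by blast
      ultimately show "k \<in> {v. \<exists>s\<in>S. s \<le> v}" using up by simp
    qed
  qed (simp add: supported_in_def)
  moreover have "monomial ` S \<subseteq> supported_in {v. \<exists>s\<in>S. s \<le> v}"
    by (auto simp: supported_in_def monomial_def)
  ultimately have "span (monomial ` S) \<subseteq> supported_in {v. \<exists>s\<in>S. s \<le> v}"
    by (simp add: span_minimal)
  moreover have "p \<in> span (monomial ` S)" if p: "p \<in> supported_in {v. \<exists>s\<in>S. s \<le> v}" for p
  proof -
    have "p = (\<Sum>k\<in>Poly_Mapping.keys p. Poly_Mapping.single k (Poly_Mapping.lookup p k))"
      by (rule poly_mapping_eqI)
        (simp add: lookup_sum lookup_single when_def sum.delta in_keys_iff)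
    moreover have "Poly_Mapping.single k a \<in> span (monomial ` S)"
      if k: "k \<in> Poly_Mapping.keys p" for k a
    proof -
      obtain s where s: "s \<in> S" "s \<le> k" using p k by (auto simp: supported_in_def)
      then have "k - s + s = k" by (simp add: vec_eq_iff less_eq_vec_def)
      then have "Poly_Mapping.single k a = Poly_Mapping.single (k - s) a * monomial s"
        by (simp add: monomial_def mult_single)
      then show ?thesis using s by (simp add: span_base span_scale)
    qed
    then have "(\<Sum>k\<in>Poly_Mapping.keys p. Poly_Mapping.single k (Poly_Mapping.lookup p k)) \<in> span (monomial ` S)"
      by (intro span_sum)
    ultimately show ?thesis by simp
  qed
  ultimately show ?thesis unfolding ideal_generated_by_def by blast
qed

text \<open>The exponents of the monomials outside \<open>irreducible_ideal u \<tau>\<close>.\<close>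

definition lower_box :: "nat ^ 'n \<Rightarrow> 'n set \<Rightarrow> (nat ^ 'n) set" where
  "lower_box u \<tau> = {v. \<forall>i\<in>\<tau>. v $ i \<le> u $ i}"

abbreviation boxes :: "((nat ^ 'n) \<times> 'n set) set \<Rightarrow> (nat ^ 'n) set" where
  "boxes D \<equiv> (\<Union>(u, \<tau>)\<in>D. lower_box u \<tau>)"

lemma irreducible_ideal_eq: "irreducible_ideal u \<tau> = supported_in (- lower_box u \<tau>)"
proof -
  have le: "axis i (Suc x) \<le> v \<longleftrightarrow> \<not> v $ i \<le> x" for i x and v :: "nat ^ 'n"
    by (auto simp: less_eq_vec_def axis_def not_le Suc_le_eq)
  have "(\<exists>s\<in>{axis i (u $ i + 1) |i. i \<in> \<tau>}. s \<le> v) \<longleftrightarrow> (\<exists>i\<in>\<tau>. \<not> v $ i \<le> u $ i)" for v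
    unfolding le[symmetric] by auto
  then have "{v. \<exists>s\<in>{axis i (u $ i + 1) |i. i \<in> \<tau>}. s \<le> v} = - lower_box u \<tau>"
    unfolding lower_box_def by blast
  moreover have "{monomial (axis i (u $ i + 1)) |i. i \<in> \<tau>} = monomial ` {axis i (u $ i + 1) |i. i \<in> \<tau>}"
    by blast
  ultimately show ?thesis
    unfolding irreducible_ideal_def by (simp add: ideal_generated_by_monomials)
qed

text \<open>The irredundant decompositions, described by complements: intersections of ideals become unions of
  boxes.\<close>

definition box_decomposition :: "(nat ^ 'n) set \<Rightarrow> ((nat ^ 'n) \<times> 'n set) set \<Rightarrow> bool" where
  "box_decomposition X D \<longleftrightarrow>
     finite D \<and> (\<forall>(u, \<tau>)\<in>D. \<forall>j. j \<notin> \<tau> \<longrightarrow> u $ j = 0) \<and> boxes D = X \<and>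
     (\<forall>D'. D' \<subset> D \<longrightarrow> boxes D' \<noteq> X)"

lemma irredundant_decomposition_iff:
  "irredundant_decomposition (supported_in (- X)) D \<longleftrightarrow> box_decomposition X D"
proof -
  have *: "(\<Inter>(u, \<tau>)\<in>D. irreducible_ideal u \<tau>) = supported_in (- boxes D)"
    for D :: "((nat ^ 'n) \<times> 'n set) set"
    unfolding irreducible_ideal_eq supported_in_def by blast
  then show ?thesis
    unfolding irredundant_decomposition_def box_decomposition_def
    by (simp only: * supported_in_inj Compl_eq_Compl_iff)
qed

lemma box_mono_iff: "lower_box u \<tau> \<subseteq> lower_box u' \<tau>' \<longleftrightarrow> \<tau>' \<subseteq> \<tau> \<and> (\<forall>i\<in>\<tau>'. u $ i \<le> u' $ i)"
proof
  assume sub: "lower_box u \<tau> \<subseteq> lower_box u' \<tau>'"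
  have "u \<in> lower_box u \<tau>" by (simp add: lower_box_def)
  then have le: "\<forall>i\<in>\<tau>'. u $ i \<le> u' $ i" using sub by (auto simp: lower_box_def)
  have "i \<in> \<tau>" if "i \<in> \<tau>'" for i
  proof (rule ccontr)
    assume "i \<notin> \<tau>"
    then have "u + axis i (u' $ i + 1) \<in> lower_box u \<tau>" by (auto simp: lower_box_def axis_def)
    then have "u + axis i (u' $ i + 1) \<in> lower_box u' \<tau>'" using sub by blast
    then have "(u + axis i (u' $ i + 1)) $ i \<le> u' $ i" using that unfolding lower_box_def by blast
    then show False by (simp add: axis_def)
  qed
  then show "\<tau>' \<subseteq> \<tau> \<and> (\<forall>i\<in>\<tau>'. u $ i \<le> u' $ i)" using le by blast
next
  assume "\<tau>' \<subseteq> \<tau> \<and> (\<forall>i\<in>\<tau>'. u $ i \<le> u' $ i)"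
  then show "lower_box u \<tau> \<subseteq> lower_box u' \<tau>'" unfolding lower_box_def using order_trans by blast
qed

text \<open>A box is directed, so it cannot be covered by finitely many boxes unless one of them contains it:
  the one that contains a point whose coordinates are maximal inside \<open>\<tau>\<close> and very large outside.\<close>

lemma box_subset_boxes:
  assumes "finite D" "lower_box u \<tau> \<subseteq> boxes D"
  shows "\<exists>(u', \<tau>')\<in>D. lower_box u \<tau> \<subseteq> lower_box u' \<tau>'"
proof -
  define N where "N = (\<Sum>(u', \<tau>')\<in>D. \<Sum>i\<in>UNIV. u' $ i) + 1"
  have N: "u' $ i < N" if "(u', \<tau>') \<in> D" for u' \<tau>' i
  proof -
    have "u' $ i \<le> (\<Sum>i\<in>UNIV. u' $ i)" by (rule member_le_sum) auto
    also have "\<dots> \<le> (\<Sum>(u', \<tau>')\<in>D. \<Sum>i\<in>UNIV. u' $ i)"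
      using member_le_sum[OF that, of "\<lambda>(u', \<tau>'). \<Sum>i\<in>UNIV. u' $ i"] assms(1) by simp
    finally show ?thesis by (simp add: N_def)
  qed
  \<comment> \<open>A box of the family that contains this point cannot bound any coordinate outside \<open>\<tau>\<close>.\<close>
  define x :: "nat ^ 'a" where "x = (\<chi> i. if i \<in> \<tau> then u $ i else N)"
  have "x \<in> lower_box u \<tau>" by (simp add: x_def lower_box_def)
  then obtain u' \<tau>' where d: "(u', \<tau>') \<in> D" "x \<in> lower_box u' \<tau>'" using assms(2) by blast
  have *: "x $ i \<le> u' $ i" if "i \<in> \<tau>'" for i using d that by (auto simp: lower_box_def)
  have "\<tau>' \<subseteq> \<tau>"
  proof
    fix i assume "i \<in> \<tau>'"
    then show "i \<in> \<tau>" using *[of i] N[OF d(1), of i] by (auto simp: x_def split: if_splits)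
  qed
  moreover have "\<forall>i\<in>\<tau>'. u $ i \<le> u' $ i"
  proof
    fix i assume "i \<in> \<tau>'"
    then show "u $ i \<le> u' $ i" using *[of i] \<open>\<tau>' \<subseteq> \<tau>\<close> by (auto simp: x_def split: if_splits)
  qed
  ultimately show ?thesis by (intro bexI[OF _ d(1)]) (simp add: box_mono_iff)
qed

text \<open>Uniqueness of the irredundant decomposition. A box of \<open>D\<close> lies in a box of \<open>D'\<close>, which lies in a box
  of \<open>D\<close>; irredundance makes the outer two equal, so the middle one is the same box.\<close>

lemma box_decomposition_subset:
  assumes D: "box_decomposition X D" and D': "box_decomposition X D'"
  shows "D \<subseteq> D'"
proof
  fix d assume d: "d \<in> D"
  have *: "finite D" "finite D'" "boxes D = X" "boxes D' = X"
    using D D' by (auto simp: box_decomposition_def)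
  obtain u \<tau> where u: "d = (u, \<tau>)" by (cases d)
  have "lower_box u \<tau> \<subseteq> boxes D'" using * d u by blast
  then obtain u' \<tau>' where u': "(u', \<tau>') \<in> D'" "lower_box u \<tau> \<subseteq> lower_box u' \<tau>'"
    using box_subset_boxes[OF *(2)] by blast
  have "lower_box u' \<tau>' \<subseteq> boxes D" using * u' by blast
  then obtain u'' \<tau>'' where u'': "(u'', \<tau>'') \<in> D" "lower_box u' \<tau>' \<subseteq> lower_box u'' \<tau>''"
    using box_subset_boxes[OF *(1)] by blast
  have "(u'', \<tau>'') = (u, \<tau>)"
  proof (rule ccontr)
    assume ne: "(u'', \<tau>'') \<noteq> (u, \<tau>)"
    have "D = insert (u, \<tau>) (D - {d})" using d u by blast
    then have "boxes D = lower_box u \<tau> \<union> boxes (D - {d})"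
      by (metis (no_types, lifting) UN_insert case_prod_conv)
    moreover have "lower_box u'' \<tau>'' \<subseteq> boxes (D - {d})"
      using u''(1) ne u UN_upper[of "(u'', \<tau>'')" "D - {d}" "\<lambda>(u, \<tau>). lower_box u \<tau>"] by simp
    ultimately have "boxes (D - {d}) = boxes D" using order_trans[OF u'(2) u''(2)] by (simp add: Un_absorb1)
    moreover have "D - {d} \<subset> D" using d by blast
    ultimately show False using D unfolding box_decomposition_def by blast
  qed
  then have "lower_box u \<tau> = lower_box u' \<tau>'" using u'(2) u''(2) by auto
  then have "\<tau> = \<tau>'" "\<forall>i\<in>\<tau>. u $ i = u' $ i"
    using box_mono_iff[of u \<tau> u' \<tau>'] box_mono_iff[of u' \<tau>' u \<tau>] by (auto intro: antisym)
  moreover have "\<forall>i. i \<notin> \<tau> \<longrightarrow> u $ i = 0" "\<forall>i. i \<notin> \<tau>' \<longrightarrow> u' $ i = 0"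
    using D D' d u u' by (auto simp: box_decomposition_def)
  ultimately have "u = u'" by (metis vec_eq_iff)
  then show "d \<in> D'" using u u' \<open>\<tau> = \<tau>'\<close> by simp
qed

text \<open>A vector avoids \<open>g\<close> if \<open>v\<^sub>i < g\<^sub>i\<close> for some \<open>i\<close>, and imposing this bound on a box gives a box again.
  Avoiding all of \<open>G\<close> is an intersection of such unions, which is distributed out one \<open>g\<close> at a time.\<close>

lemma boxes_avoiding_finite:
  assumes "finite G"
  shows "\<exists>D. finite D \<and> (\<forall>(u, \<tau>)\<in>D. \<forall>j. j \<notin> \<tau> \<longrightarrow> u $ j = 0) \<and>
    boxes D = - {v. \<exists>g\<in>G. g \<le> v}"
  using assms
proof (induction G)
  case empty
  show ?case by (intro exI[of _ "{(0, {})}"]) (auto simp: lower_box_def)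
next
  case (insert g G)
  then obtain D where D: "finite D" "\<forall>(u, \<tau>)\<in>D. \<forall>j. j \<notin> \<tau> \<longrightarrow> u $ j = 0"
    "boxes D = - {v. \<exists>g\<in>G. g \<le> v}" by (elim exE conjE)
  \<comment> \<open>Only coordinates with \<open>g\<^sub>i \<noteq> 0\<close> are cut, so the truncated \<open>g $ i - 1\<close> is the true predecessor.\<close>
  define cut where "cut d i =
    ((\<chi> j. if j = i then (if i \<in> snd d then min (fst d $ i) (g $ i - 1) else g $ i - 1) else fst d $ j),
      insert i (snd d))" for d :: "(nat ^ 'a) \<times> 'a set" and i
  have cut: "lower_box (fst (cut d i)) (snd (cut d i)) = lower_box (fst d) (snd d) \<inter> {v. v $ i < g $ i}"
    if "g $ i \<noteq> 0" for d i
    using that by (auto simp: cut_def lower_box_def split: if_splits)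
  define D' where "D' = case_prod cut ` (D \<times> {i. g $ i \<noteq> 0})"
  have "boxes D' = (\<Union>d\<in>D. \<Union>i\<in>{i. g $ i \<noteq> 0}. lower_box (fst (cut d i)) (snd (cut d i)))"
    unfolding D'_def by (force simp: case_prod_beta)
  also have "\<dots> = (\<Union>d\<in>D. \<Union>i\<in>{i. g $ i \<noteq> 0}. lower_box (fst d) (snd d) \<inter> {v. v $ i < g $ i})"
    using cut by auto
  also have "\<dots> = boxes D \<inter> - {v. g \<le> v}"
  proof -
    have "v \<in> - {v. g \<le> v} \<longleftrightarrow> (\<exists>i\<in>{i. g $ i \<noteq> 0}. v $ i < g $ i)" for v
      by (force simp: less_eq_vec_def not_le)
    then show ?thesis by (auto simp: case_prod_beta)
  qed
  also have "\<dots> = - {v. \<exists>g\<in>insert g G. g \<le> v}" unfolding D(3) by blast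
  finally have "boxes D' = - {v. \<exists>g\<in>insert g G. g \<le> v}" .
  moreover have "finite D'" unfolding D'_def using D(1) by auto
  moreover have "\<forall>(u, \<tau>)\<in>D'. \<forall>j. j \<notin> \<tau> \<longrightarrow> u $ j = 0"
    using D(2) unfolding D'_def cut_def by auto
  ultimately show ?case by (intro exI[of _ D'] conjI)
qed

text \<open>By Dickson's lemma the complement of \<open>X\<close> has finitely many minimal elements, and a minimal
  subfamily of a finite family of boxes that covers \<open>X\<close> is irredundant.\<close>

lemma box_decomposition_exists:
  fixes X :: "(nat ^ 'n) set"
  assumes down: "\<And>u v. v \<in> X \<Longrightarrow> u \<le> v \<Longrightarrow> u \<in> X"
  shows "\<exists>D. box_decomposition X D"
proof -
  obtain G where G: "finite G" "G \<subseteq> - X"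
    "\<forall>x\<in>-X. \<exists>g\<in>G. \<forall>f\<in>range (\<lambda>i v. v $ i). f g \<le> f x"
    using dickson[of "range (\<lambda>(i::'n) (v::nat ^ 'n). v $ i)" "- X", OF finite_imageI[OF finite]]
    by (elim exE conjE)
  have "{v. \<exists>g\<in>G. g \<le> v} = - X"
  proof
    show "{v. \<exists>g\<in>G. g \<le> v} \<subseteq> - X" using G(2) down by blast
    show "- X \<subseteq> {v. \<exists>g\<in>G. g \<le> v}" using G(3) by (auto simp: less_eq_vec_def)
  qed
  then obtain D0 where D0: "finite D0" "\<forall>(u, \<tau>)\<in>D0. \<forall>j. j \<notin> \<tau> \<longrightarrow> u $ j = 0" "boxes D0 = X"
    using boxes_avoiding_finite[OF G(1)] by auto
  have "finite {D. D \<subseteq> D0 \<and> boxes D = X}" using D0(1) by simp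
  moreover have "{D. D \<subseteq> D0 \<and> boxes D = X} \<noteq> {}" using D0(3) by blast
  ultimately obtain D where D: "D \<in> {D. D \<subseteq> D0 \<and> boxes D = X}"
    and min: "\<forall>D'\<in>{D. D \<subseteq> D0 \<and> boxes D = X}. D' \<subseteq> D \<longrightarrow> D = D'"
    using finite_has_minimal[of "{D. D \<subseteq> D0 \<and> boxes D = X}"] by (elim meta_impE bexE)
  have "box_decomposition X D"
    unfolding box_decomposition_def
  proof (intro conjI)
    have sub: "D \<subseteq> D0" and eq: "boxes D = X" using D by simp_all
    show "finite D" using sub D0(1) finite_subset by blast
    show "\<forall>(u, \<tau>)\<in>D. \<forall>j. j \<notin> \<tau> \<longrightarrow> u $ j = 0"
      by (rule ballI, rule bspec[OF D0(2)], rule subsetD[OF sub])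
    show "boxes D = X" by (rule eq)
    show "\<forall>D'. D' \<subset> D \<longrightarrow> boxes D' \<noteq> X"
    proof (intro allI impI notI)
      fix D' assume D': "D' \<subset> D" "boxes D' = X"
      then have "D' \<in> {D. D \<subseteq> D0 \<and> boxes D = X}" using sub by simp
      then have "D = D'" using bspec[OF min] D'(1) by (simp add: less_imp_le)
      then show False using D'(1) by simp
    qed
  qed
  then show ?thesis by (rule exI)
qed

lemma irreducible_components_box_decomposition:
  fixes X :: "(nat ^ 'n) set"
  assumes down: "\<And>u v. v \<in> X \<Longrightarrow> u \<le> v \<Longrightarrow> u \<in> X"
  shows "box_decomposition X (irreducible_components (supported_in (- X)))"
proof -
  have "\<exists>D. box_decomposition X D" by (rule box_decomposition_exists) (rule down)
  then obtain D where D: "box_decomposition X D" by (elim exE)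
  moreover have "D' = D" if "box_decomposition X D'" for D'
    using box_decomposition_subset[OF that D] box_decomposition_subset[OF D that] by simp
  ultimately show ?thesis
    unfolding irreducible_components_def irredundant_decomposition_iff by (rule theI)
qed

section \<open>Optimal vectors and the cones they determine\<close>

definition optimal_vectors :: "int ^ 'n ^ 'd \<Rightarrow> real ^ 'n \<Rightarrow> (nat ^ 'n) set" where
  "optimal_vectors A c = {u. \<not> non_optimal A c u}"

lemma optimal_iff:
  "u \<in> optimal_vectors A c \<longleftrightarrow> (\<forall>w. fiber A w = fiber A u \<longrightarrow> c \<bullet> rvec u \<le> c \<bullet> rvec w)"
  by (auto simp: optimal_vectors_def non_optimal_def ip_feasible_eq)

lemma optimal_le: "u \<in> optimal_vectors A c \<Longrightarrow> fiber A w = fiber A u \<Longrightarrow> c \<bullet> rvec u \<le> c \<bullet> rvec w"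
  by (simp add: optimal_iff)

lemma le_vec_obtain_diff:
  fixes u v :: "nat ^ 'n"
  assumes "u \<le> v"
  obtains r where "v = u + r"
  using that[of "v - u"] assms by (simp add: vec_eq_iff less_eq_vec_def)

text \<open>An improvement of \<open>u\<close> within its fiber, plus the difference \<open>v - u\<close>, is an improvement of \<open>v\<close>.\<close>

lemma optimal_vectors_down:
  assumes v: "v \<in> optimal_vectors A c" and "u \<le> v"
  shows "u \<in> optimal_vectors A c"
  unfolding optimal_iff
proof (intro allI impI)
  fix w assume w: "fiber A w = fiber A u"
  obtain r where r: "v = u + r" using \<open>u \<le> v\<close> by (rule le_vec_obtain_diff)
  have "fiber A (w + r) = fiber A v" using w by (simp add: r fiber_add)
  then have "c \<bullet> rvec v \<le> c \<bullet> rvec (w + r)" by (rule optimal_le[OF v])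
  then show "c \<bullet> rvec u \<le> c \<bullet> rvec w" by (simp add: r rvec_add inner_add_right)
qed

lemma non_optimal_ideal_eq: "non_optimal_ideal A c = supported_in (- optimal_vectors A c)"
proof -
  have "{v. \<exists>s\<in>- optimal_vectors A c. s \<le> v} = - optimal_vectors A c"
    using optimal_vectors_down[of _ A c] by blast
  moreover have "{monomial u |u. non_optimal A c u} = monomial ` (- optimal_vectors A c)"
    by (auto simp: optimal_vectors_def)
  ultimately show ?thesis
    unfolding non_optimal_ideal_def by (simp add: ideal_generated_by_monomials)
qed

text \<open>Otherwise the multiples of \<open>r\<close> make the program of the zero fiber unbounded.\<close>

lemma bounded_costs_nonneg:
  assumes c: "c \<in> bounded_costs A" and r: "fiber A r = 0"
  shows "0 \<le> c \<bullet> rvec r"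
proof (rule ccontr)
  assume neg: "\<not> 0 \<le> c \<bullet> rvec r"
  obtain m where m: "\<And>w. fiber A w = 0 \<Longrightarrow> m \<le> c \<bullet> rvec w"
    using c unfolding bounded_costs_def ip_bounded_def ip_feasible_eq bdd_below_def
    by (auto dest: spec[of _ 0])
  obtain k :: nat where k: "real k * (- (c \<bullet> rvec r)) > - m"
    using reals_Archimedean3[of "- (c \<bullet> rvec r)"] neg by (meson neg_0_less_iff_less not_le)
  have "fiber A (k *s r) = 0" using r by (simp add: fiber_scale vec_eq_iff)
  then have "m \<le> c \<bullet> rvec (k *s r)" by (rule m)
  then show False using k by (simp add: rvec_scale)
qed

text \<open>By Dickson's lemma finitely many vectors of a fiber lie below all others, and going up within a
  fiber adds a nonnegative kernel vector, which does not lower a bounded cost. So one of the finitely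
  many has minimal cost.\<close>

lemma exists_optimal:
  fixes A :: "int ^ 'n ^ 'd"
  assumes c: "c \<in> bounded_costs A"
  shows "\<exists>w\<in>optimal_vectors A c. fiber A w = fiber A u"
proof -
  define S where "S = {w. fiber A w = fiber A u}"
  obtain G where G: "finite G" "G \<subseteq> S"
    "\<forall>x\<in>S. \<exists>g\<in>G. \<forall>f\<in>range (\<lambda>i v. v $ i). f g \<le> f x"
    using dickson[of "range (\<lambda>(i::'n) (v::nat ^ 'n). v $ i)" S, OF finite_imageI[OF finite]]
    by (elim exE conjE)
  have dom: "\<exists>g\<in>G. c \<bullet> rvec g \<le> c \<bullet> rvec x" if x: "x \<in> S" for x
  proof -
    obtain g where g: "g \<in> G" "g \<le> x" using G(3) x by (auto simp: less_eq_vec_def)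
    obtain r where r: "x = g + r" using g(2) by (rule le_vec_obtain_diff)
    have "fiber A x = fiber A g" using x g G(2) unfolding S_def by auto
    then have "0 \<le> c \<bullet> rvec r" by (intro bounded_costs_nonneg[OF c]) (simp add: r fiber_add)
    then have "c \<bullet> rvec g \<le> c \<bullet> rvec x" by (simp add: r rvec_add inner_add_right)
    then show ?thesis using g(1) by blast
  qed
  have "u \<in> S" by (simp add: S_def)
  then have "G \<noteq> {}" using dom by blast
  then obtain w where w: "w \<in> G" "\<And>g. g \<in> G \<Longrightarrow> c \<bullet> rvec w \<le> c \<bullet> rvec g"
    using ex_is_arg_min_if_finite[OF G(1), of "\<lambda>g. c \<bullet> rvec g"]
    unfolding is_arg_min_linorder by metis
  have wu: "fiber A w = fiber A u" using w(1) G(2) by (auto simp: S_def)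
  have "w \<in> optimal_vectors A c"
    unfolding optimal_iff
  proof (intro allI impI)
    fix x assume "fiber A x = fiber A w"
    then have "x \<in> S" using wu by (simp add: S_def)
    then show "c \<bullet> rvec w \<le> c \<bullet> rvec x" using dom w(2) order_trans by blast
  qed
  then show ?thesis using wu by blast
qed

lemma bounded_costsI:
  assumes "\<And>u. \<exists>w\<in>optimal_vectors A c. fiber A w = fiber A u"
  shows "c \<in> bounded_costs A"
  unfolding bounded_costs_def ip_bounded_def ip_feasible_eq
proof (intro CollectI allI)
  fix b
  show "bdd_below ((\<lambda>u. c \<bullet> real_vec u) ` int_vec ` {w. fiber A w = b})"
  proof (cases "\<exists>u. fiber A u = b")
    case True
    then obtain w where "w \<in> optimal_vectors A c" "fiber A w = b" using assms by blast
    then show ?thesis by (intro bdd_belowI[of _ "c \<bullet> rvec w"]) (auto simp: optimal_iff)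
  next
    case False
    then have "{w. fiber A w = b} = {}" by blast
    then show ?thesis by simp
  qed
qed

lemma nonneg_in_bounded_costs: "(\<And>i. 0 \<le> c $ i) \<Longrightarrow> c \<in> bounded_costs A"
  unfolding bounded_costs_def ip_bounded_def ip_feasible_eq
  by (auto intro!: bdd_belowI[of _ 0] sum_nonneg simp: inner_vec_def)

text \<open>For bounded \<open>c\<close>, the closure of the set of cost vectors with the same optimal vectors. Asking for an inclusion
  and not for equality includes the boundary, where further vectors tie with the optimal ones.\<close>

definition groebner_cone :: "int ^ 'n ^ 'd \<Rightarrow> real ^ 'n \<Rightarrow> (real ^ 'n) set" where
  "groebner_cone A c = {c'. optimal_vectors A c \<subseteq> optimal_vectors A c'}"

lemma groebner_cone_refl [simp]: "c \<in> groebner_cone A c"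
  by (simp add: groebner_cone_def)

lemma groebner_cone_bounded:
  assumes "c \<in> bounded_costs A"
  shows "groebner_cone A c \<subseteq> bounded_costs A"
proof
  fix c' assume "c' \<in> groebner_cone A c"
  then have sub: "optimal_vectors A c \<subseteq> optimal_vectors A c'" by (simp add: groebner_cone_def)
  show "c' \<in> bounded_costs A"
  proof (rule bounded_costsI)
    fix u
    show "\<exists>w\<in>optimal_vectors A c'. fiber A w = fiber A u"
      using exists_optimal[OF assms, of u] by (rule bexE) (rule bexI, assumption, rule subsetD[OF sub])
  qed
qed

lemma groebner_cone_mono: "d \<in> groebner_cone A c \<Longrightarrow> groebner_cone A d \<subseteq> groebner_cone A c"
  unfolding groebner_cone_def by blast

lemma convex_cone_groebner_cone: "convex_cone (groebner_cone A c)"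
proof -
  have "0 \<in> groebner_cone A c" by (simp add: groebner_cone_def subset_eq optimal_iff)
  moreover have "x + y \<in> groebner_cone A c" if "x \<in> groebner_cone A c" "y \<in> groebner_cone A c" for x y
    using that unfolding groebner_cone_def subset_eq optimal_iff
    by (auto simp: inner_add_left intro!: add_mono)
  moreover have "a *\<^sub>R x \<in> groebner_cone A c" if "x \<in> groebner_cone A c" "0 \<le> a" for x a
    using that unfolding groebner_cone_def subset_eq optimal_iff
    by (auto intro!: mult_left_mono)
  ultimately show ?thesis by (auto simp: convex_cone_iff)
qed

text \<open>Membership in a cone is an inequality for each pair of vectors in a common fiber. Such pairs form a
  monoid with a finite Hilbert basis, and the summands of an optimal vector are optimal. So the
  inequalities of the basis pairs imply all others; the same basis works for every \<open>c\<close>.\<close>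

lemma fiber_pair_basis:
  fixes A :: "int ^ 'n ^ 'd"
  shows "\<exists>H. finite H \<and> (\<forall>(u, w)\<in>H. fiber A u = fiber A w) \<and>
    (\<forall>c. groebner_cone A c =
      {c'. \<forall>(u, w)\<in>H. u \<in> optimal_vectors A c \<longrightarrow> c' \<bullet> rvec u \<le> c' \<bullet> rvec w})"
proof -
  define S where "S = {(u, w). fiber A u = fiber A w}"
  define F where "F = range (\<lambda>i (x::(nat ^ 'n) \<times> (nat ^ 'n)). fst x $ i) \<union> range (\<lambda>i x. snd x $ i)"
  have "\<exists>H. finite H \<and> H \<subseteq> S \<and>
      (\<forall>P. P 0 \<longrightarrow> (\<forall>x\<in>S. \<forall>h\<in>H. P x \<longrightarrow> P (x + h)) \<longrightarrow> (\<forall>x\<in>S. P x))"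
  proof (rule hilbert_basis)
    show "finite F" by (simp add: F_def)
    show "f (x + y) = f x + f y" if "f \<in> F" for f x y using that by (auto simp: F_def)
    show "x = 0" if "\<forall>f\<in>F. f x = 0" for x
      using that by (auto simp: F_def prod_eq_iff vec_eq_iff)
    show "\<exists>z\<in>S. y = z + x" if xy: "x \<in> S" "y \<in> S" "\<forall>f\<in>F. f x \<le> f y" for x y
    proof -
      have "fst x \<le> fst y" "snd x \<le> snd y"
        using xy(3) unfolding F_def less_eq_vec_def ball_Un by simp_all
      then obtain r r' where r: "fst y = fst x + r" "snd y = snd x + r'"
        by (meson le_vec_obtain_diff)
      then have "(r, r') \<in> S" using xy(1,2) by (auto simp: S_def fiber_add)
      then show ?thesis using r by (intro bexI[of _ "(r, r')"]) (auto simp: prod_eq_iff add.commute)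
    qed
  qed
  then obtain H where H: "finite H" "H \<subseteq> S"
    and ind: "\<forall>P. P 0 \<longrightarrow> (\<forall>x\<in>S. \<forall>h\<in>H. P x \<longrightarrow> P (x + h)) \<longrightarrow> (\<forall>x\<in>S. P x)"
    by (elim exE conjE)
  have "groebner_cone A c =
      {c'. \<forall>(u, w)\<in>H. u \<in> optimal_vectors A c \<longrightarrow> c' \<bullet> rvec u \<le> c' \<bullet> rvec w}" for c
  proof (intro equalityI subsetI CollectI)
    fix c' assume c': "c' \<in> groebner_cone A c"
    show "\<forall>(u, w)\<in>H. u \<in> optimal_vectors A c \<longrightarrow> c' \<bullet> rvec u \<le> c' \<bullet> rvec w"
    proof clarify
      fix u w assume uw: "(u, w) \<in> H" "u \<in> optimal_vectors A c"
      have "u \<in> optimal_vectors A c'" using uw(2) c' by (auto simp: groebner_cone_def)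
      moreover have "fiber A w = fiber A u" using uw(1) H(2) by (auto simp: S_def)
      ultimately show "c' \<bullet> rvec u \<le> c' \<bullet> rvec w" by (rule optimal_le)
    qed
  next
    fix c' assume c': "c' \<in> {c'. \<forall>(u, w)\<in>H. u \<in> optimal_vectors A c \<longrightarrow> c' \<bullet> rvec u \<le> c' \<bullet> rvec w}"
    define P where "P x \<longleftrightarrow> (fst x \<in> optimal_vectors A c \<longrightarrow> c' \<bullet> rvec (fst x) \<le> c' \<bullet> rvec (snd x))" for x
    have step: "P (x + h)" if h: "h \<in> H" and x: "P x" for x h
      unfolding P_def
    proof
      assume opt: "fst (x + h) \<in> optimal_vectors A c"
      have "fst x \<le> fst (x + h)" "fst h \<le> fst (x + h)" by (auto simp: less_eq_vec_def)
      then have "fst x \<in> optimal_vectors A c" "fst h \<in> optimal_vectors A c"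
        using optimal_vectors_down[OF opt] by auto
      then have "c' \<bullet> rvec (fst x) \<le> c' \<bullet> rvec (snd x)" "c' \<bullet> rvec (fst h) \<le> c' \<bullet> rvec (snd h)"
        using x h c' unfolding P_def by auto
      then show "c' \<bullet> rvec (fst (x + h)) \<le> c' \<bullet> rvec (snd (x + h))"
        by (simp add: rvec_add inner_add_right)
    qed
    have "P 0" by (simp add: P_def)
    moreover have "\<forall>x\<in>S. \<forall>h\<in>H. P x \<longrightarrow> P (x + h)" by (intro ballI impI step)
    ultimately have "\<forall>x\<in>S. P x" by (rule spec[OF ind, THEN mp, THEN mp])
    then have "c' \<bullet> rvec u \<le> c' \<bullet> rvec w"
      if "u \<in> optimal_vectors A c" "fiber A w = fiber A u" for u w
      using that by (auto simp: P_def S_def dest: bspec[of _ _ "(u, w)"])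
    then show "c' \<in> groebner_cone A c" by (auto simp: groebner_cone_def optimal_iff[of _ A c'])
  qed
  then show ?thesis using H by (intro exI[of _ H]) (auto simp: S_def)
qed

lemma finite_groebner_cones: "finite (range (groebner_cone A))"
proof -
  obtain H where H: "finite H" "\<And>c. groebner_cone A c =
      {c'. \<forall>(u, w)\<in>H. u \<in> optimal_vectors A c \<longrightarrow> c' \<bullet> rvec u \<le> c' \<bullet> rvec w}"
    using fiber_pair_basis[of A] by (elim exE conjE) simp
  have "groebner_cone A c \<in> (\<lambda>J. {c'. \<forall>(u, w)\<in>J. c' \<bullet> rvec u \<le> c' \<bullet> rvec w}) ` Pow H" for c
  proof (rule image_eqI)
    show "groebner_cone A c = {c'. \<forall>(u, w)\<in>{h\<in>H. fst h \<in> optimal_vectors A c}. c' \<bullet> rvec u \<le> c' \<bullet> rvec w}"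
      unfolding H(2) by (simp add: Ball_def case_prod_beta imp_conjL)
  qed simp
  then have "range (groebner_cone A) \<subseteq> (\<lambda>J. {c'. \<forall>(u, w)\<in>J. c' \<bullet> rvec u \<le> c' \<bullet> rvec w}) ` Pow H"
    by blast
  then show ?thesis using H(1) finite_subset by blast
qed

lemma polyhedron_groebner_cone: "polyhedron (groebner_cone A c)"
proof -
  obtain H where H: "finite H" "\<And>c. groebner_cone A c =
      {c'. \<forall>(u, w)\<in>H. u \<in> optimal_vectors A c \<longrightarrow> c' \<bullet> rvec u \<le> c' \<bullet> rvec w}"
    using fiber_pair_basis[of A] by (elim exE conjE) simp
  have "groebner_cone A c =
      \<Inter> ((\<lambda>(u, w). {x. (rvec w - rvec u) \<bullet> x \<ge> 0}) ` {h\<in>H. fst h \<in> optimal_vectors A c})"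
    unfolding H(2)
    by (auto simp: case_prod_beta inner_diff_right inner_commute[of "rvec _ - rvec _"])
  moreover have "polyhedron (\<Inter> ((\<lambda>(u, w). {x. (rvec w - rvec u) \<bullet> x \<ge> 0}) `
      {h\<in>H. fst h \<in> optimal_vectors A c}))"
  proof (rule polyhedron_Inter)
    show "finite ((\<lambda>(u, w). {x. (rvec w - rvec u) \<bullet> x \<ge> 0}) ` {h\<in>H. fst h \<in> optimal_vectors A c})"
      using H(1) by simp
  next
    fix S assume "S \<in> (\<lambda>(u, w). {x. (rvec w - rvec u) \<bullet> x \<ge> 0}) ` {h\<in>H. fst h \<in> optimal_vectors A c}"
    then obtain h where "S = {x. (rvec (snd h) - rvec (fst h)) \<bullet> x \<ge> 0}" by (auto simp: case_prod_beta)
    then show "polyhedron S" by (simp only: polyhedron_halfspace_ge)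
  qed
  ultimately show ?thesis by simp
qed

lemma closed_groebner_cone: "closed (groebner_cone A c)"
  by (simp add: polyhedron_groebner_cone polyhedron_imp_closed)

lemma convex_groebner_cone: "convex (groebner_cone A c)"
  by (simp add: polyhedron_groebner_cone polyhedron_imp_convex)

text \<open>Let \<open>z\<close> lie strictly between \<open>x\<close> and \<open>y\<close>, let \<open>v\<close> be optimal for \<open>x\<close> and \<open>y\<close>, and let \<open>u\<close> in the same
  fiber be optimal for \<open>z\<close>. Neither \<open>x\<close> nor \<open>y\<close> prefers \<open>u\<close> to \<open>v\<close>, but their combination \<open>z\<close> does not
  prefer \<open>v\<close> to \<open>u\<close>. Hence both are indifferent and \<open>u\<close> is optimal for them as well.\<close>

lemma groebner_cone_Int_face:
  assumes c: "c \<in> bounded_costs A"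
  shows "(groebner_cone A c \<inter> groebner_cone A d) face_of groebner_cone A c"
proof -
  have abs: "optimal_vectors A d \<subseteq> optimal_vectors A x"
    if x: "x \<in> groebner_cone A c" and y: "y \<in> groebner_cone A c"
      and z: "z \<in> groebner_cone A d" and t: "0 < t" "t < 1" "z = (1 - t) *\<^sub>R x + t *\<^sub>R y" for x y z t
  proof
    fix u assume u: "u \<in> optimal_vectors A d"
    obtain v where v: "v \<in> optimal_vectors A c" "fiber A v = fiber A u" using exists_optimal[OF c] by blast
    have vx: "v \<in> optimal_vectors A x" and vy: "v \<in> optimal_vectors A y" and uz: "u \<in> optimal_vectors A z"
      using v u x y z by (auto simp: groebner_cone_def)
    have "x \<bullet> rvec v \<le> x \<bullet> rvec u" "y \<bullet> rvec v \<le> y \<bullet> rvec u" "z \<bullet> rvec u \<le> z \<bullet> rvec v"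
      using vx vy uz v(2) by (simp_all add: optimal_iff)
    then have "(1 - t) * (x \<bullet> rvec u - x \<bullet> rvec v) + t * (y \<bullet> rvec u - y \<bullet> rvec v) \<le> 0"
      "t * (y \<bullet> rvec u - y \<bullet> rvec v) \<ge> 0"
      using t by (auto simp: inner_add_left algebra_simps)
    then have "(1 - t) * (x \<bullet> rvec u - x \<bullet> rvec v) \<le> 0" by linarith
    then have "x \<bullet> rvec u \<le> x \<bullet> rvec v" using t by (simp add: mult_le_0_iff)
    then show "u \<in> optimal_vectors A x" using vx v(2) by (auto simp: optimal_iff intro: order_trans)
  qed
  show ?thesis
    unfolding face_of_def
  proof (intro conjI ballI impI)
    show "convex (groebner_cone A c \<inter> groebner_cone A d)" by (intro convex_Int convex_groebner_cone)
    fix x y z assume x: "x \<in> groebner_cone A c" and y: "y \<in> groebner_cone A c"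
      and z: "z \<in> groebner_cone A c \<inter> groebner_cone A d" and seg: "z \<in> open_segment x y"
    obtain t where t: "0 < t" "t < 1" "z = (1 - t) *\<^sub>R x + t *\<^sub>R y"
      using seg by (auto simp: in_segment)
    have z': "z = (1 - (1 - t)) *\<^sub>R y + (1 - t) *\<^sub>R x" using t(3) by (simp add: add.commute)
    show "x \<in> groebner_cone A c \<inter> groebner_cone A d"
      using abs[OF x y _ t] x z by (auto simp: groebner_cone_def)
    show "y \<in> groebner_cone A c \<inter> groebner_cone A d"
      using abs[OF y x _ _ _ z'] t y z by (auto simp: groebner_cone_def)
  qed simp
qed

lemma groebner_cone_face:
  assumes "c \<in> bounded_costs A" "d \<in> groebner_cone A c"
  shows "groebner_cone A d face_of groebner_cone A c"
  using groebner_cone_Int_face[OF assms(1), of d] groebner_cone_mono[OF assms(2)]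
  by (simp add: Int_absorb1)

text \<open>The segment from any \<open>x\<close> in the cone to \<open>d\<close> can be prolonged a little within the cone. A basis
  inequality that is strict at \<open>d\<close> survives a small step. If it is an equality at \<open>d\<close>, both vectors are
  optimal for \<open>d\<close>, hence for \<open>x\<close>, and the equality holds along the whole line.\<close>

lemma in_rel_interior_groebner_cone: "d \<in> rel_interior (groebner_cone A d)"
proof -
  obtain H where H: "finite H" "\<forall>(u, w)\<in>H. fiber A u = fiber A w"
      "\<And>c. groebner_cone A c =
      {c'. \<forall>(u, w)\<in>H. u \<in> optimal_vectors A c \<longrightarrow> c' \<bullet> rvec u \<le> c' \<bullet> rvec w}"
    using fiber_pair_basis[of A] by (elim exE conjE) simp
  have "\<exists>e. e > 1 \<and> (1 - e) *\<^sub>R x + e *\<^sub>R d \<in> groebner_cone A d" if x: "x \<in> groebner_cone A d" for x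
  proof -
    \<comment> \<open>The inequality of the basis pair \<open>h\<close> at the point \<open>d + t (d - x)\<close>.\<close>
    define ok where "ok h t \<longleftrightarrow> (fst h \<in> optimal_vectors A d \<longrightarrow>
      0 \<le> (d \<bullet> rvec (snd h) - d \<bullet> rvec (fst h)) + t * ((d - x) \<bullet> rvec (snd h) - (d - x) \<bullet> rvec (fst h)))" for h t
    have "\<forall>\<^sub>F t in at_right 0. ok h t" if h: "h \<in> H" for h
    proof (cases "fst h \<in> optimal_vectors A d")
      case True
      have fib: "fiber A (snd h) = fiber A (fst h)" using H(2) h by auto
      show ?thesis
      proof (cases "d \<bullet> rvec (snd h) = d \<bullet> rvec (fst h)")
        case eq: True
        then have "snd h \<in> optimal_vectors A d" using True fib by (simp add: optimal_iff)
        then have "fst h \<in> optimal_vectors A x" "snd h \<in> optimal_vectors A x"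
          using True x by (auto simp: groebner_cone_def)
        then have "x \<bullet> rvec (snd h) = x \<bullet> rvec (fst h)"
          using fib by (intro antisym) (auto simp: optimal_iff)
        then show ?thesis using eq by (simp add: ok_def inner_diff_left)
      next
        case False
        then have pos: "0 < d \<bullet> rvec (snd h) - d \<bullet> rvec (fst h)"
          using True fib optimal_le by (metis diff_gt_0_iff_gt order_le_less)
        have "((\<lambda>t. (d \<bullet> rvec (snd h) - d \<bullet> rvec (fst h)) + t * ((d - x) \<bullet> rvec (snd h) - (d - x) \<bullet> rvec (fst h)))
            \<longlongrightarrow> (d \<bullet> rvec (snd h) - d \<bullet> rvec (fst h)) + 0 * ((d - x) \<bullet> rvec (snd h) - (d - x) \<bullet> rvec (fst h))) (at_right 0)"
          by (intro tendsto_intros)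
        then have "\<forall>\<^sub>F t in at_right 0. 0 < (d \<bullet> rvec (snd h) - d \<bullet> rvec (fst h)) + t * ((d - x) \<bullet> rvec (snd h) - (d - x) \<bullet> rvec (fst h))"
          using pos by (intro order_tendstoD(1)) auto
        then show ?thesis by (rule eventually_mono) (simp add: ok_def)
      qed
    qed (simp add: ok_def)
    then have "\<forall>\<^sub>F t in at_right 0. \<forall>h\<in>H. ok h t" using H(1) by (simp add: eventually_ball_finite)
    moreover have "\<forall>\<^sub>F t in at_right 0. (0::real) < t" by (simp add: eventually_at_right_less)
    ultimately have "\<forall>\<^sub>F t in at_right 0. 0 < t \<and> (\<forall>h\<in>H. ok h t)" by eventually_elim simp
    then obtain t where t: "0 < t" "\<forall>h\<in>H. ok h t"
      using eventually_happens[of _ "at_right (0::real)"] by auto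
    have "(1 - (1 + t)) *\<^sub>R x + (1 + t) *\<^sub>R d = d + t *\<^sub>R (d - x)" by (simp add: algebra_simps)
    moreover have "d + t *\<^sub>R (d - x) \<in> groebner_cone A d"
      unfolding H(3)
    proof (intro CollectI ballI, clarify)
      fix u w assume "(u, w) \<in> H" "u \<in> optimal_vectors A d"
      then have "0 \<le> (d \<bullet> rvec w - d \<bullet> rvec u) + t * ((d - x) \<bullet> rvec w - (d - x) \<bullet> rvec u)"
        using bspec[OF t(2)] unfolding ok_def by fastforce
      then show "(d + t *\<^sub>R (d - x)) \<bullet> rvec u \<le> (d + t *\<^sub>R (d - x)) \<bullet> rvec w"
        by (simp add: inner_add_left algebra_simps)
    qed
    ultimately show ?thesis using t(1) by (intro exI[of _ "1 + t"]) simp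
  qed
  moreover have "groebner_cone A d \<noteq> {}" using groebner_cone_refl by blast
  ultimately show ?thesis
    using convex_rel_interior_iff[OF convex_groebner_cone] by blast
qed

text \<open>The cone of \<open>c\<close> is a face of the cone of \<open>d\<close> that meets its relative interior, so the two agree.\<close>

lemma rel_interior_groebner_cone:
  assumes d: "d \<in> bounded_costs A" and c: "c \<in> rel_interior (groebner_cone A d)"
  shows "optimal_vectors A c = optimal_vectors A d"
proof
  have c': "c \<in> groebner_cone A d" using c rel_interior_subset by blast
  then show "optimal_vectors A d \<subseteq> optimal_vectors A c" by (simp add: groebner_cone_def)
  have "groebner_cone A d \<subseteq> groebner_cone A c"
    using subset_of_face_of[OF groebner_cone_face[OF d c'] subset_refl] c groebner_cone_refl[of c A]
    by (meson disjoint_iff)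
  then show "optimal_vectors A c \<subseteq> optimal_vectors A d"
    using groebner_cone_refl[of d A] by (auto simp: groebner_cone_def)
qed

section \<open>The Groebner fan\<close>

text \<open>If \<open>C \<subseteq> D \<subseteq> E\<close> with \<open>C\<close> and \<open>E\<close> in the same fan, then \<open>C\<close> is a face of \<open>E\<close> and therefore of \<open>D\<close>.\<close>

lemma polyhedral_fan_mutual_refinement:
  assumes F: "polyhedral_fan F" and G: "polyhedral_fan G"
    and FG: "\<forall>C\<in>F. \<exists>D\<in>G. C \<subseteq> D" and GF: "\<forall>D\<in>G. \<exists>C\<in>F. D \<subseteq> C"
  shows "F \<subseteq> G"
proof
  fix C assume C: "C \<in> F"
  obtain D where D: "D \<in> G" "C \<subseteq> D" using FG C by (elim ballE bexE) auto
  obtain E where E: "E \<in> F" "D \<subseteq> E" using GF D(1) by (elim ballE bexE) auto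
  have "C \<inter> E face_of E" using F C E(1) by (simp add: polyhedral_fan_def)
  then have "C face_of E" using D(2) E(2) by (simp add: Int_absorb2)
  then have "C face_of D" using D(2) E(2) by (rule face_of_subset)
  moreover have "C \<noteq> {}" using F C by (auto simp: polyhedral_fan_def convex_cone_def)
  ultimately show "C \<in> G" using G D(1) unfolding polyhedral_fan_def by (elim conjE) simp
qed

text \<open>A nonempty face is the cone of any point in its relative interior.\<close>

lemma polyhedral_fan_groebner_cones:
  "polyhedral_fan (groebner_cone A ` bounded_costs A)"
  unfolding polyhedral_fan_def
proof (intro conjI ballI allI impI)
  show "finite (groebner_cone A ` bounded_costs A)"
    by (rule finite_subset[OF _ finite_groebner_cones[of A]]) blast
next
  fix C assume "C \<in> groebner_cone A ` bounded_costs A"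
  then show "convex_cone C" "polyhedron C"
    using convex_cone_groebner_cone polyhedron_groebner_cone by auto
next
  fix C D assume C: "C \<in> groebner_cone A ` bounded_costs A" and D: "D face_of C \<and> D \<noteq> {}"
  obtain c where c: "c \<in> bounded_costs A" "C = groebner_cone A c" using C by auto
  have "convex D" "D \<subseteq> C" using D face_of_imp_convex[of D C] face_of_imp_subset[of D C] by auto
  then obtain d where d: "d \<in> rel_interior D" using D rel_interior_eq_empty by blast
  then have dC: "d \<in> groebner_cone A c" using \<open>D \<subseteq> C\<close> c(2) rel_interior_subset by blast
  have "D \<subseteq> groebner_cone A d"
    using subset_of_face_of[OF groebner_cone_face[OF c(1) dC]] d \<open>D \<subseteq> C\<close> c(2) groebner_cone_refl[of d A]
    by (meson disjoint_iff)
  moreover have "groebner_cone A d \<subseteq> D"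
    using subset_of_face_of[of D C "groebner_cone A d"] D c(2) groebner_cone_mono[OF dC]
      in_rel_interior_groebner_cone[of d A] d rel_interior_subset[of D] by blast
  moreover have "d \<in> bounded_costs A" using dC groebner_cone_bounded[OF c(1)] by blast
  ultimately show "D \<in> groebner_cone A ` bounded_costs A" by blast
next
  fix C D assume "C \<in> groebner_cone A ` bounded_costs A" "D \<in> groebner_cone A ` bounded_costs A"
  then obtain c d where cd: "c \<in> bounded_costs A" "d \<in> bounded_costs A"
    "C = groebner_cone A c" "D = groebner_cone A d" by blast
  show "C \<inter> D face_of C" unfolding cd by (rule groebner_cone_Int_face[OF cd(1)])
  show "C \<inter> D face_of D" unfolding cd by (subst Int_commute) (rule groebner_cone_Int_face[OF cd(2)])
qed

lemma same_ideal_iff: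
  "non_optimal_ideal A c = non_optimal_ideal A c' \<longleftrightarrow> optimal_vectors A c = optimal_vectors A c'"
  by (simp add: non_optimal_ideal_eq)

lemma ideal_constant_groebner_cones:
  "ideal_constant_fan A (groebner_cone A ` bounded_costs A)"
  unfolding ideal_constant_fan_def
proof (intro conjI ballI)
  show "polyhedral_fan (groebner_cone A ` bounded_costs A)" by (rule polyhedral_fan_groebner_cones)
  show "\<Union> (groebner_cone A ` bounded_costs A) = bounded_costs A"
    using groebner_cone_bounded groebner_cone_refl by blast
next
  fix C c c' assume "C \<in> groebner_cone A ` bounded_costs A" "c \<in> rel_interior C" "c' \<in> rel_interior C"
  then obtain d where "d \<in> bounded_costs A" "c \<in> rel_interior (groebner_cone A d)"
    "c' \<in> rel_interior (groebner_cone A d)" by auto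
  then show "non_optimal_ideal A c = non_optimal_ideal A c'"
    unfolding same_ideal_iff using rel_interior_groebner_cone by blast
qed

text \<open>The cost vectors in the relative interior of \<open>C\<close> share their optimal vectors, and the closure of the
  relative interior contains \<open>C\<close>.\<close>

lemma ideal_constant_fan_refines:
  assumes F: "ideal_constant_fan A F" and C: "C \<in> F"
  shows "\<exists>D\<in>groebner_cone A ` bounded_costs A. C \<subseteq> D"
proof -
  have conv: "convex C" "C \<noteq> {}"
    using F C by (auto simp: ideal_constant_fan_def polyhedral_fan_def convex_cone_def)
  then obtain d where d: "d \<in> rel_interior C" using rel_interior_eq_empty by blast
  have "d \<in> \<Union>F" using d C rel_interior_subset by blast
  moreover have "\<Union>F = bounded_costs A" using F unfolding ideal_constant_fan_def by (elim conjE)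
  ultimately have bd: "d \<in> bounded_costs A" by blast
  have const: "\<forall>C\<in>F. \<forall>c\<in>rel_interior C. \<forall>c'\<in>rel_interior C.
      non_optimal_ideal A c = non_optimal_ideal A c'"
    using F unfolding ideal_constant_fan_def by (elim conjE)
  have "rel_interior C \<subseteq> groebner_cone A d"
  proof
    fix c assume c: "c \<in> rel_interior C"
    have "non_optimal_ideal A c = non_optimal_ideal A d"
      by (rule bspec[OF bspec[OF bspec[OF const C] c] d])
    then show "c \<in> groebner_cone A d" by (simp add: same_ideal_iff groebner_cone_def)
  qed
  then have "closure (rel_interior C) \<subseteq> groebner_cone A d"
    by (rule closure_minimal) (rule closed_groebner_cone)
  then have "C \<subseteq> groebner_cone A d"
    using convex_closure_rel_interior[OF conv(1)] closure_subset[of C] by simp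
  then show ?thesis using bd by blast
qed

lemma groebner_fan_eq: "groebner_fan A = groebner_cone A ` bounded_costs A"
  unfolding groebner_fan_def
proof (rule the_equality)
  show *: "ideal_constant_fan A (groebner_cone A ` bounded_costs A) \<and>
    (\<forall>F'. ideal_constant_fan A F' \<longrightarrow> (\<forall>C'\<in>F'. \<exists>C\<in>groebner_cone A ` bounded_costs A. C' \<subseteq> C))"
    by (intro conjI allI impI ballI ideal_constant_groebner_cones ideal_constant_fan_refines)
  fix F assume F: "ideal_constant_fan A F \<and>
    (\<forall>F'. ideal_constant_fan A F' \<longrightarrow> (\<forall>C'\<in>F'. \<exists>C\<in>F. C' \<subseteq> C))"
  have fans: "polyhedral_fan F" "polyhedral_fan (groebner_cone A ` bounded_costs A)"
    using F * by (auto simp: ideal_constant_fan_def)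
  have 1: "\<forall>C\<in>F. \<exists>D\<in>groebner_cone A ` bounded_costs A. C \<subseteq> D"
    by (intro ballI ideal_constant_fan_refines[OF conjunct1[OF F]])
  have 2: "\<forall>C\<in>groebner_cone A ` bounded_costs A. \<exists>D\<in>F. C \<subseteq> D" using conjunct2[OF F, THEN spec, THEN mp, OF conjunct1[OF *]] .
  show "F = groebner_cone A ` bounded_costs A"
    using polyhedral_fan_mutual_refinement[OF fans 1 2]
      polyhedral_fan_mutual_refinement[OF fans(2,1) 2 1] by (rule equalityI)
qed

lemma interior_finite_Union_empty:
  assumes "finite F" "\<And>C. C \<in> F \<Longrightarrow> closed C" "\<And>C. C \<in> F \<Longrightarrow> interior C = {}"
  shows "interior (\<Union>F) = {}"
  using assms
proof (induction F)
  case (insert C F)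
  then have "interior (\<Union>F) = {}" by simp
  then show ?case using insert.prems interior_closed_Un_empty_interior[of C "\<Union>F"] by simp
qed simp

text \<open>Boundedness is preserved by adding a nonnegative vector, so open balls of bounded costs come
  arbitrarily close to \<open>c\<close>. No ball is covered by the finitely many cones with empty interior.\<close>

lemma in_full_dimensional_cone:
  fixes A :: "int ^ 'n ^ 'd"
  assumes c: "c \<in> bounded_costs A"
  shows "\<exists>K\<in>groebner_fan A. interior K \<noteq> {} \<and> c \<in> K"
proof -
  define F where "F = groebner_cone A ` bounded_costs A"
  have F: "finite F" "\<And>C. C \<in> F \<Longrightarrow> closed C" "\<Union>F = bounded_costs A"
    using polyhedral_fan_groebner_cones[of A] ideal_constant_groebner_cones[of A] closed_groebner_cone
    unfolding F_def polyhedral_fan_def ideal_constant_fan_def by auto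
  define U where "U = \<Union>{K\<in>F. interior K \<noteq> {}}"
  have "closed U" unfolding U_def using F by (intro closed_Union) auto
  have thin: "interior (\<Union>{K\<in>F. interior K = {}}) = {}"
    using F by (intro interior_finite_Union_empty) auto
  define g :: "real ^ 'n" where "g = (\<chi> i. 1)"
  have ball: "ball (c + e *\<^sub>R g) e \<subseteq> bounded_costs A" if e: "e > 0" for e
  proof
    fix x assume x: "x \<in> ball (c + e *\<^sub>R g) e"
    have "0 \<le> (x - c) $ i" for i
    proof -
      have "\<bar>(x - (c + e *\<^sub>R g)) $ i\<bar> \<le> norm (x - (c + e *\<^sub>R g))" by (rule component_le_norm_cart)
      also have "\<dots> < e" using x by (simp add: dist_norm norm_minus_commute)
      finally show ?thesis by (simp add: g_def)
    qed
    then have xc: "x - c \<in> bounded_costs A" by (rule nonneg_in_bounded_costs)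
    show "x \<in> bounded_costs A" 
      unfolding bounded_costs_def ip_bounded_def
    proof (intro CollectI allI)
      fix b
      obtain m where m: "\<And>u. u \<in> ip_feasible A b \<Longrightarrow> m \<le> c \<bullet> real_vec u"
        using c unfolding bounded_costs_def ip_bounded_def bdd_below_def by blast
      obtain m' where m': "\<And>u. u \<in> ip_feasible A b \<Longrightarrow> m' \<le> (x - c) \<bullet> real_vec u"
        using xc unfolding bounded_costs_def ip_bounded_def bdd_below_def by blast
      show "bdd_below ((\<lambda>u. x \<bullet> real_vec u) ` ip_feasible A b)"
      proof (rule bdd_belowI2)
        fix u assume "u \<in> ip_feasible A b"
        then have "m + m' \<le> c \<bullet> real_vec u + (x - c) \<bullet> real_vec u" by (intro add_mono m m')
        then show "m + m' \<le> x \<bullet> real_vec u" by (simp add: inner_diff_left)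
      qed
    qed
  qed
  have "c \<in> closure U"
    unfolding closure_approachable
  proof (intro allI impI)
    fix e :: real assume e: "e > 0"
    define e' where "e' = e / (norm g + 1)"
    have e': "e' > 0" "e' * (norm g + 1) = e"
      using e add_nonneg_pos[OF norm_ge_zero[of g] zero_less_one] by (simp_all add: e'_def)
    have "\<not> ball (c + e' *\<^sub>R g) e' \<subseteq> \<Union>{K\<in>F. interior K = {}}"
    proof
      assume sub: "ball (c + e' *\<^sub>R g) e' \<subseteq> \<Union>{K\<in>F. interior K = {}}"
      have "ball (c + e' *\<^sub>R g) e' \<subseteq> {}" using interior_maximal[OF sub open_ball] unfolding thin .
      moreover have "c + e' *\<^sub>R g \<in> ball (c + e' *\<^sub>R g) e'" using e'(1) by simp
      ultimately show False by blast
    qed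
    then obtain x where x: "x \<in> ball (c + e' *\<^sub>R g) e'" "x \<notin> \<Union>{K\<in>F. interior K = {}}" by (meson subsetI)
    have "x \<in> \<Union>F" using x(1) ball[OF e'(1)] F(3) by auto
    then have "x \<in> U" using x(2) unfolding U_def by auto
    moreover have "dist x c < e"
    proof -
      have "norm (x - c) \<le> norm (x - (c + e' *\<^sub>R g)) + norm (e' *\<^sub>R g)"
        using norm_triangle_ineq[of "x - (c + e' *\<^sub>R g)" "e' *\<^sub>R g"] by simp
      also have "\<dots> < e' + e' * norm g" using x(1) e'(1) by (simp add: dist_norm norm_minus_commute)
      also have "\<dots> = e" using e'(2) by (simp add: algebra_simps)
      finally show ?thesis by (simp add: dist_norm)
    qed
    ultimately show "\<exists>y\<in>U. dist y c < e" by blast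
  qed
  then have "c \<in> U" using \<open>closed U\<close> by simp
  then show ?thesis unfolding U_def F_def groebner_fan_eq by blast
qed

text \<open>A full-dimensional cone that contains \<open>c\<close> contains the whole cone of \<open>c\<close>.\<close>

lemma maximal_cone_interior:
  assumes "K \<in> maximal_cones (groebner_fan A)"
  shows "K \<in> groebner_fan A" "interior K \<noteq> {}"
proof -
  show K: "K \<in> groebner_fan A" using assms by (simp add: maximal_cones_def)
  then obtain c where c: "c \<in> bounded_costs A" "K = groebner_cone A c" by (auto simp: groebner_fan_eq)
  obtain K' where K': "K' \<in> groebner_fan A" "interior K' \<noteq> {}" "c \<in> K'"
    using in_full_dimensional_cone[OF c(1)] by blast
  then obtain d where "K' = groebner_cone A d" by (auto simp: groebner_fan_eq)
  then have "K \<subseteq> K'" using groebner_cone_mono K'(3) c(2) by blast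
  then have "K' = K" using assms K'(1) by (simp add: maximal_cones_def)
  then show "interior K \<noteq> {}" using K'(2) by simp
qed

lemma optimal_vectors_on_cone:
  assumes K: "K \<in> groebner_fan A" and c: "c \<in> interior K"
  shows "K = groebner_cone A c" "c \<in> bounded_costs A"
    "cone_ideal A K = supported_in (- optimal_vectors A c)"
proof -
  obtain d where d: "d \<in> bounded_costs A" "K = groebner_cone A d" using K by (auto simp: groebner_fan_eq)
  have int: "rel_interior K = interior K" using c by (intro rel_interior_nonempty_interior) auto
  have same: "optimal_vectors A c' = optimal_vectors A d" if "c' \<in> interior K" for c'
    using rel_interior_groebner_cone[OF d(1), of c'] that int d(2) by simp
  show "K = groebner_cone A c" using same[OF c] d(2) by (simp add: groebner_cone_def)
  show "c \<in> bounded_costs A" using c d groebner_cone_bounded interior_subset by blast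
  show "cone_ideal A K = supported_in (- optimal_vectors A c)"
    unfolding cone_ideal_def
  proof (rule the_equality)
    show "\<forall>c'\<in>interior K. non_optimal_ideal A c' = supported_in (- optimal_vectors A c)"
      using same c by (auto simp: non_optimal_ideal_eq)
  next
    fix M assume "\<forall>c'\<in>interior K. non_optimal_ideal A c' = M"
    then show "M = supported_in (- optimal_vectors A c)" using c by (auto simp: non_optimal_ideal_eq)
  qed
qed

section \<open>The relaxed linear programs\<close>

definition free_part :: "'n set \<Rightarrow> nat ^ 'n" where
  "free_part \<tau> = (\<chi> i. if i \<in> \<tau> then 0 else 1)"

text \<open>The rational points of the relaxed program are written as \<open>(p - m e) / q\<close> with \<open>e\<close> the indicator
  vector of the coordinates outside \<open>\<tau>\<close>. Adding a multiple of \<open>e\<close> makes the free coordinates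
  nonnegative, so that \<open>p\<close> is a natural vector and can be compared with optimal vectors.\<close>

definition unshift :: "'n set \<Rightarrow> nat \<Rightarrow> nat ^ 'n \<Rightarrow> real ^ 'n" where
  "unshift \<tau> m p = rvec p - real m *\<^sub>R rvec (free_part \<tau>)"

text \<open>The triples \<open>(q, m, p)\<close> form a monoid. Those with \<open>q > 0\<close> represent feasible points of the relaxed
  program, those with \<open>q = 0\<close> its recession directions.\<close>

definition fractional_points :: "int ^ 'n ^ 'd \<Rightarrow> nat ^ 'n \<Rightarrow> 'n set \<Rightarrow> (nat \<times> nat \<times> (nat ^ 'n)) set" where
  "fractional_points A u \<tau> = {(q, m, p). fiber A p = fiber A (q *s u + m *s free_part \<tau>)}"

lemma unshift_add: "unshift \<tau> (m + l) (p + r) = unshift \<tau> m p + unshift \<tau> l r"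
  by (simp add: unshift_def rvec_add algebra_simps)

lemma mem_fractional_points:
  "(q, m, p) \<in> fractional_points A u \<tau> \<longleftrightarrow>
    rmat A *v unshift \<tau> m p = real q *\<^sub>R (rmat A *v rvec u)"
proof -
  have "rmat A *v unshift \<tau> m p = rmat A *v rvec p - real m *\<^sub>R (rmat A *v rvec (free_part \<tau>))"
    by (simp add: unshift_def matrix_vector_mult_diff_distrib matrix_vector_mult_scaleR)
  moreover have "rmat A *v rvec (q *s u + m *s free_part \<tau>) =
      real q *\<^sub>R (rmat A *v rvec u) + real m *\<^sub>R (rmat A *v rvec (free_part \<tau>))"
    by (simp add: rvec_add rvec_scale matrix_vector_right_distrib matrix_vector_mult_scaleR)
  ultimately show ?thesis
    by (simp add: fractional_points_def fiber_eq_iff diff_eq_eq)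
qed

lemma fractional_point_feasible:
  assumes "(q, m, p) \<in> fractional_points A u \<tau>" "q > 0"
  shows "(1 / real q) *\<^sub>R unshift \<tau> m p \<in> relaxed_feasible A u \<tau>"
  using assms unfolding mem_fractional_points relaxed_feasible_def
  by (auto simp: matrix_vector_mult_scaleR unshift_def free_part_def)

lemma fractional_points_basis:
  fixes A :: "int ^ 'n ^ 'd"
  shows "\<exists>H. finite H \<and> H \<subseteq> fractional_points A u \<tau> \<and>
    (\<forall>P. P 0 \<longrightarrow> (\<forall>x\<in>fractional_points A u \<tau>. \<forall>h\<in>H. P x \<longrightarrow> P (x + h)) \<longrightarrow>
      (\<forall>x\<in>fractional_points A u \<tau>. P x))"
proof -
  define F where "F = {fst, \<lambda>x::nat \<times> nat \<times> (nat ^ 'n). fst (snd x)} \<union> range (\<lambda>i x. snd (snd x) $ i)"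
  show ?thesis
  proof (rule hilbert_basis)
    show "finite F" by (simp add: F_def)
    show "f (x + y) = f x + f y" if "f \<in> F" for f x y using that by (auto simp: F_def)
    show "x = 0" if "\<forall>f\<in>F. f x = 0" for x
      using that by (auto simp: F_def prod_eq_iff vec_eq_iff)
    show "\<exists>z\<in>fractional_points A u \<tau>. y = z + x"
      if x: "x \<in> fractional_points A u \<tau>" and y: "y \<in> fractional_points A u \<tau>"
        and le: "\<forall>f\<in>F. f x \<le> f y" for x y
    proof -
      obtain q m p q' m' p' where xy: "x = (q, m, p)" "y = (q', m', p')" by (metis prod.collapse)
      have le': "q \<le> q'" "m \<le> m'" "p \<le> p'"
        using le unfolding F_def less_eq_vec_def ball_Un xy by simp_all
      obtain k where k: "q' = q + k" using le'(1) le_Suc_ex by blast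
      obtain l where l: "m' = m + l" using le'(2) le_Suc_ex by blast
      obtain r where r: "p' = p + r" using le'(3) by (rule le_vec_obtain_diff)
      have "(k, l, r) \<in> fractional_points A u \<tau>"
        using x y unfolding xy k l r mem_fractional_points unshift_add
        by (simp add: matrix_vector_right_distrib algebra_simps)
      then show ?thesis unfolding xy k l r by (intro bexI[of _ "(k, l, r)"]) (auto simp: add.commute)
    qed
  qed
qed

text \<open>The relaxed program attains its minimum over the rational points. On a finitely generated monoid
  the ratio of cost to denominator is smallest at a generator with positive denominator, provided
  that the generators with denominator 0 have nonnegative cost. For those, \<open>p\<close> lies in the fiber of
  \<open>m e\<close>, which is optimal.\<close>

lemma best_fractional_point:
  fixes A :: "int ^ 'n ^ 'd"
  assumes opt: "\<And>N. u + N *s free_part \<tau> \<in> optimal_vectors A c"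
  obtains q0 m0 p0 where "(q0, m0, p0) \<in> fractional_points A u \<tau>" "q0 > 0"
    "\<And>q m p. (q, m, p) \<in> fractional_points A u \<tau> \<Longrightarrow>
      real q * (c \<bullet> unshift \<tau> m0 p0) \<le> real q0 * (c \<bullet> unshift \<tau> m p)"
proof -
  obtain H where H: "finite H" "H \<subseteq> fractional_points A u \<tau>"
    and ind: "\<forall>P. P 0 \<longrightarrow> (\<forall>x\<in>fractional_points A u \<tau>. \<forall>h\<in>H. P x \<longrightarrow> P (x + h)) \<longrightarrow>
      (\<forall>x\<in>fractional_points A u \<tau>. P x)"
    using fractional_points_basis[of A u \<tau>] by (elim exE conjE)
  define r where "r h = (c \<bullet> unshift \<tau> (fst (snd h)) (snd (snd h))) / real (fst h)" for h
  have "{h\<in>H. fst h > 0} \<noteq> {}"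
  proof
    assume empty: "{h\<in>H. fst h > 0} = {}"
    have "fst h = 0" if "h \<in> H" for h
    proof (rule ccontr)
      assume "fst h \<noteq> 0"
      then have "h \<in> {h\<in>H. fst h > 0}" using that by simp
      then show False unfolding empty by simp
    qed
    define Q where "Q x \<longleftrightarrow> fst x = 0" for x :: "nat \<times> nat \<times> (nat ^ 'n)"
    have "Q 0" by (simp add: Q_def)
    moreover have "\<forall>x\<in>fractional_points A u \<tau>. \<forall>h\<in>H. Q x \<longrightarrow> Q (x + h)"
      using \<open>\<And>h. h \<in> H \<Longrightarrow> fst h = 0\<close> by (simp add: Q_def)
    ultimately have "\<forall>x\<in>fractional_points A u \<tau>. Q x" by (rule spec[OF ind, THEN mp, THEN mp])
    moreover have "(1, 0, u) \<in> fractional_points A u \<tau>"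
      by (simp add: mem_fractional_points unshift_def)
    ultimately have "Q (1, 0, u)" by (rule bspec)
    then show False by (simp add: Q_def)
  qed
  then obtain h0 where h0: "h0 \<in> H" "fst h0 > 0" "\<And>h. h \<in> H \<Longrightarrow> fst h > 0 \<Longrightarrow> r h0 \<le> r h"
    using ex_is_arg_min_if_finite[of "{h\<in>H. fst h > 0}" r] H(1)
    unfolding is_arg_min_linorder by auto
  obtain q0 m0 p0 where eq0: "h0 = (q0, m0, p0)" by (metis prod.collapse)
  have q0: "q0 > 0" using h0(2) eq0 by simp
  define P where "P x \<longleftrightarrow> real (fst x) * (c \<bullet> unshift \<tau> m0 p0) \<le>
      real q0 * (c \<bullet> unshift \<tau> (fst (snd x)) (snd (snd x)))" for x
  have PH: "P h" if h: "h \<in> H" for h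
  proof (cases "fst h > 0")
    case True
    then show ?thesis
      using h0(3)[OF h] q0 unfolding r_def P_def eq0 by (simp add: field_simps)
  next
    case False
    obtain q m p where eq: "h = (q, m, p)" by (metis prod.collapse)
    have "m *s free_part \<tau> \<le> u + m *s free_part \<tau>" by (simp add: less_eq_vec_def)
    then have "m *s free_part \<tau> \<in> optimal_vectors A c" by (rule optimal_vectors_down[OF opt])
    moreover have "fiber A p = fiber A (m *s free_part \<tau>)"
      using h H(2) False eq by (auto simp: fractional_points_def fiber_add fiber_scale)
    ultimately have "c \<bullet> rvec (m *s free_part \<tau>) \<le> c \<bullet> rvec p" by (rule optimal_le)
    then show ?thesis using False eq by (simp add: P_def unshift_def rvec_scale inner_diff_right)
  qed
  have "rvec 0 = (0 :: real ^ 'n)" by (simp add: vec_eq_iff)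
  then have "P 0" by (simp add: P_def unshift_def)
  moreover have "\<forall>x\<in>fractional_points A u \<tau>. \<forall>h\<in>H. P x \<longrightarrow> P (x + h)"
    using PH by (auto simp: P_def unshift_add inner_add_right algebra_simps intro!: add_mono)
  ultimately have "\<forall>x\<in>fractional_points A u \<tau>. P x" by (rule spec[OF ind, THEN mp, THEN mp])
  then have "P (q, m, p)" if "(q, m, p) \<in> fractional_points A u \<tau>" for q m p using that by blast
  then show ?thesis using that[of q0 m0 p0] h0(1) H(2) q0 eq0 unfolding P_def by auto
qed

text \<open>The reason why the solution of the relaxed program does not change within a cone. Multiplying out
  the denominators and shifting by a multiple of \<open>e\<close>, the best point becomes an optimal vector \<open>a\<close> of
  an integer program, the point to compare with becomes \<open>b\<close> in the same fiber, and optimality of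
  integer vectors persists throughout the cone.\<close>

lemma best_fractional_point_on_cone:
  assumes p0: "(q0, m0, p0) \<in> fractional_points A u \<tau>" and q0: "q0 > 0"
    and best: "\<And>q m p. (q, m, p) \<in> fractional_points A u \<tau> \<Longrightarrow>
      real q * (c0 \<bullet> unshift \<tau> m0 p0) \<le> real q0 * (c0 \<bullet> unshift \<tau> m p)"
    and c: "c \<in> groebner_cone A c0" and p: "(q, m, p) \<in> fractional_points A u \<tau>"
  shows "real q * (c \<bullet> unshift \<tau> m0 p0) \<le> real q0 * (c \<bullet> unshift \<tau> m p)"
proof -
  define a where "a = q *s p0 + (q0 * m) *s free_part \<tau>"
  define b where "b = q0 *s p + (q * m0) *s free_part \<tau>"
  have ab: "rvec a = real q *\<^sub>R unshift \<tau> m0 p0 + real (q * m0 + q0 * m) *\<^sub>R rvec (free_part \<tau>)"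
    "rvec b = real q0 *\<^sub>R unshift \<tau> m p + real (q * m0 + q0 * m) *\<^sub>R rvec (free_part \<tau>)"
    by (simp_all add: a_def b_def unshift_def rvec_add rvec_scale algebra_simps)
  have fib: "rmat A *v rvec a = rmat A *v rvec b"
    "rmat A *v rvec a = real (q0 * q) *\<^sub>R (rmat A *v rvec u) + real (q * m0 + q0 * m) *\<^sub>R (rmat A *v rvec (free_part \<tau>))"
    using p p0 by (simp_all add: ab mem_fractional_points matrix_vector_right_distrib
      matrix_vector_mult_scaleR algebra_simps)
  have "a \<in> optimal_vectors A c0"
    unfolding optimal_iff
  proof (intro allI impI)
    fix w assume "fiber A w = fiber A a"
    then have "(q0 * q, q * m0 + q0 * m, w) \<in> fractional_points A u \<tau>"
      using fib(2) by (simp add: mem_fractional_points fiber_eq_iff unshift_def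
        matrix_vector_mult_diff_distrib matrix_vector_mult_scaleR)
    then have "real q0 * (real q * (c0 \<bullet> unshift \<tau> m0 p0)) \<le> real q0 * (c0 \<bullet> unshift \<tau> (q * m0 + q0 * m) w)"
      using best[of "q0 * q" "q * m0 + q0 * m" w] by (simp add: mult.assoc)
    then have "real q * (c0 \<bullet> unshift \<tau> m0 p0) \<le> c0 \<bullet> unshift \<tau> (q * m0 + q0 * m) w" using q0 by simp
    then show "c0 \<bullet> rvec a \<le> c0 \<bullet> rvec w"
      by (simp add: ab inner_add_right unshift_def[of \<tau> "q * m0 + q0 * m"] inner_diff_right)
  qed
  then have "a \<in> optimal_vectors A c" using c by (auto simp: groebner_cone_def)
  then have "c \<bullet> rvec a \<le> c \<bullet> rvec b" by (rule optimal_le) (simp add: fiber_eq_iff fib(1))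
  then show ?thesis by (simp add: ab inner_add_right)
qed

text \<open>A lower bound over the rational points holds over all real points, by \<open>rational_approximation\<close>
  applied to \<open>v\<close> after a shift that makes it nonnegative.\<close>

lemma relaxed_lower_bound:
  fixes A :: "int ^ 'n ^ 'd"
  assumes r: "\<And>q m p. (q, m, p) \<in> fractional_points A u \<tau> \<Longrightarrow> real q * r \<le> c \<bullet> unshift \<tau> m p"
    and v: "v \<in> relaxed_feasible A u \<tau>"
  shows "r \<le> c \<bullet> v"
proof (rule field_le_epsilon)
  fix \<delta> :: real assume \<delta>: "\<delta> > 0"
  define C where "C = (\<Sum>i\<in>UNIV. \<bar>c $ i\<bar>) + 1"
  have C: "C > 0" unfolding C_def by (intro add_nonneg_pos sum_nonneg) auto
  obtain M :: nat where M: "(\<Sum>i\<in>UNIV. \<bar>v $ i\<bar>) \<le> real M" using real_arch_simple by blast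
  define x where "x = v + real M *\<^sub>R rvec (free_part \<tau>)"
  have "0 \<le> x $ i" for i
  proof (cases "i \<in> \<tau>")
    case True
    then show ?thesis using v by (simp add: x_def free_part_def relaxed_feasible_def)
  next
    case False
    have "\<bar>v $ i\<bar> \<le> (\<Sum>i\<in>UNIV. \<bar>v $ i\<bar>)" by (rule member_le_sum) auto
    then show ?thesis using M False by (simp add: x_def free_part_def)
  qed
  moreover have "rmat A *v x = real_vec (fiber A (u + M *s free_part \<tau>))"
    using v by (simp add: x_def relaxed_feasible_def real_vec_mult[symmetric] rvec_add rvec_scale
      matrix_vector_right_distrib)
  ultimately obtain q p where q: "0 < q" and p: "fiber A p = int q *s fiber A (u + M *s free_part \<tau>)"
    and approx: "\<forall>i. \<bar>real q * x $ i - real (p $ i)\<bar> < \<delta> / C"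
    using rational_approximation[of A x _ "\<delta> / C"] \<delta> C by (metis divide_pos_pos)
  have "q *s (u + M *s free_part \<tau>) = q *s u + (q * M) *s free_part \<tau>"
    by (simp add: vec_eq_iff algebra_simps)
  then have "(q, q * M, p) \<in> fractional_points A u \<tau>"
    using p by (simp add: fractional_points_def fiber_scale[symmetric])
  then have "real q * r \<le> c \<bullet> unshift \<tau> (q * M) p" by (rule r)
  also have "\<dots> = real q * (c \<bullet> v) + c \<bullet> (rvec p - real q *\<^sub>R x)"
    by (simp add: unshift_def x_def inner_diff_right inner_add_right algebra_simps)
  also have "c \<bullet> (rvec p - real q *\<^sub>R x) \<le> (\<Sum>i\<in>UNIV. \<bar>c $ i\<bar> * (\<delta> / C))"
    unfolding inner_vec_def
  proof (intro sum_mono)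
    fix i
    have "c $ i \<bullet> (rvec p - real q *\<^sub>R x) $ i \<le> \<bar>c $ i\<bar> * \<bar>real q * x $ i - real (p $ i)\<bar>"
      by (simp add: abs_mult[symmetric] abs_minus_commute)
    also have "\<dots> \<le> \<bar>c $ i\<bar> * (\<delta> / C)" using approx by (intro mult_left_mono) (auto intro: less_imp_le)
    finally show "c $ i \<bullet> (rvec p - real q *\<^sub>R x) $ i \<le> \<bar>c $ i\<bar> * (\<delta> / C)" .
  qed
  also have "(\<Sum>i\<in>UNIV. \<bar>c $ i\<bar> * (\<delta> / C)) = (C - 1) * (\<delta> / C)"
    unfolding sum_distrib_right[symmetric] by (simp add: C_def)
  also have "\<dots> \<le> \<delta>" using C \<delta> by (simp add: field_simps)
  also have "\<delta> \<le> real q * \<delta>" using q \<delta> by simp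
  finally have "real q * r \<le> real q * (c \<bullet> v + \<delta>)" by (simp add: algebra_simps)
  then show "r \<le> c \<bullet> v + \<delta>" using q by simp
qed

lemma relaxed_optimal_exists:
  assumes opt: "\<And>N. u + N *s free_part \<tau> \<in> optimal_vectors A c0"
  shows "\<exists>v. \<forall>c\<in>groebner_cone A c0. relaxed_optimal A c u \<tau> v"
proof -
  obtain q0 m0 p0 where p0: "(q0, m0, p0) \<in> fractional_points A u \<tau>" and q0: "q0 > 0"
    and best: "\<And>q m p. (q, m, p) \<in> fractional_points A u \<tau> \<Longrightarrow>
      real q * (c0 \<bullet> unshift \<tau> m0 p0) \<le> real q0 * (c0 \<bullet> unshift \<tau> m p)"
    using best_fractional_point[OF opt] by blast
  define v where "v = (1 / real q0) *\<^sub>R unshift \<tau> m0 p0"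
  have "relaxed_optimal A c u \<tau> v" if c: "c \<in> groebner_cone A c0" for c
    unfolding relaxed_optimal_def
  proof (intro conjI ballI)
    show "v \<in> relaxed_feasible A u \<tau>" unfolding v_def by (rule fractional_point_feasible[OF p0 q0])
    fix w assume w: "w \<in> relaxed_feasible A u \<tau>"
    have "c \<bullet> v \<le> c \<bullet> w"
    proof (rule relaxed_lower_bound[OF _ w])
      fix q m p assume p: "(q, m, p) \<in> fractional_points A u \<tau>"
      have "real q * (c \<bullet> unshift \<tau> m0 p0) \<le> real q0 * (c \<bullet> unshift \<tau> m p)"
        by (rule best_fractional_point_on_cone[OF p0 q0 _ c p]) (rule best)
      then show "real q * (c \<bullet> v) \<le> c \<bullet> unshift \<tau> m p"
        using q0 by (simp add: v_def field_simps)
    qed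
    then show "c \<bullet> rvec u - c \<bullet> w \<le> c \<bullet> rvec u - c \<bullet> v" by simp
  qed
  then show ?thesis by blast
qed

section \<open>The gap on a cone of the Groebner fan\<close>

lemma ip_value_optimal:
  assumes "u \<in> optimal_vectors A c"
  shows "ip_value A c (fiber A u) = c \<bullet> rvec u"
  unfolding ip_value_def
proof (rule cInf_eq_minimum)
  show "c \<bullet> rvec u \<in> (\<lambda>u. c \<bullet> real_vec u) ` ip_feasible A (fiber A u)"
    by (auto simp: ip_feasible_eq)
qed (use assms in \<open>auto simp: ip_feasible_eq optimal_iff\<close>)

definition component_gap :: "int ^ 'n ^ 'd \<Rightarrow> (real ^ 'n) set \<Rightarrow> (nat ^ 'n) \<times> 'n set \<Rightarrow> real ^ 'n" where
  "component_gap A K d = rvec (fst d) - relaxed_solution A K (fst d) (snd d)"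

abbreviation cone_components :: "int ^ 'n ^ 'd \<Rightarrow> (real ^ 'n) set \<Rightarrow> ((nat ^ 'n) \<times> 'n set) set" where
  "cone_components A K \<equiv> irreducible_components (cone_ideal A K)"

lemma components_box_decomposition:
  assumes "K \<in> groebner_fan A" "c0 \<in> interior K"
  shows "box_decomposition (optimal_vectors A c0) (cone_components A K)"
  unfolding optimal_vectors_on_cone(3)[OF assms]
  by (rule irreducible_components_box_decomposition) (rule optimal_vectors_down)

lemma components_finite_nonempty:
  assumes "K \<in> groebner_fan A" "interior K \<noteq> {}"
  shows "finite (cone_components A K)" "cone_components A K \<noteq> {}"
proof -
  obtain c0 where c0: "c0 \<in> interior K" using assms(2) by blast
  note D = components_box_decomposition[OF assms(1) c0]
  show "finite (cone_components A K)" using D unfolding box_decomposition_def by (elim conjE)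
  obtain w where "w \<in> optimal_vectors A c0"
    using exists_optimal[OF optimal_vectors_on_cone(2)[OF assms(1) c0]] by blast
  moreover have "boxes (cone_components A K) = optimal_vectors A c0"
    using D unfolding box_decomposition_def by (elim conjE)
  ultimately show "cone_components A K \<noteq> {}" by auto
qed

text \<open>Two vectors that are optimal for all cost vectors in the interior differ by a vector orthogonal to
  an open set, so the simultaneous optimal solution is unique. It is optimal on the boundary of the
  cone as well.\<close>

lemma relaxed_solution_optimal:
  assumes K: "K \<in> groebner_fan A" "interior K \<noteq> {}"
    and d: "(u, \<tau>) \<in> cone_components A K" and c: "c \<in> K"
  shows "relaxed_optimal A c u \<tau> (relaxed_solution A K u \<tau>)"
proof -
  obtain c0 where c0: "c0 \<in> interior K" using K(2) by blast
  have D: "boxes (cone_components A K) = optimal_vectors A c0"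
    using components_box_decomposition[OF K(1) c0] unfolding box_decomposition_def by (elim conjE)
  have "u + N *s free_part \<tau> \<in> optimal_vectors A c0" for N
  proof -
    have "u + N *s free_part \<tau> \<in> lower_box u \<tau>" by (simp add: lower_box_def free_part_def)
    then show ?thesis unfolding D[symmetric] using d by blast
  qed
  then obtain v where v: "\<forall>c\<in>groebner_cone A c0. relaxed_optimal A c u \<tau> v"
    using relaxed_optimal_exists[of u \<tau> A c0] by auto
  then have vK: "relaxed_optimal A c u \<tau> v" if "c \<in> K" for c
    using optimal_vectors_on_cone(1)[OF K(1) c0] that by auto
  have "relaxed_solution A K u \<tau> = v"
    unfolding relaxed_solution_def
  proof (rule the_equality)
    show "\<forall>c\<in>interior K. relaxed_optimal A c u \<tau> v" using vK interior_subset by blast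
    fix v' assume v': "\<forall>c\<in>interior K. relaxed_optimal A c u \<tau> v'"
    have orth: "c \<bullet> (v' - v) = 0" if "c \<in> interior K" for c
    proof -
      have "relaxed_optimal A c u \<tau> v" "relaxed_optimal A c u \<tau> v'"
        using v' vK that interior_subset by blast+
      then have "c \<bullet> v \<le> c \<bullet> v'" "c \<bullet> v' \<le> c \<bullet> v"
        unfolding relaxed_optimal_def by (force dest: bspec)+
      then show ?thesis by (simp add: inner_diff_right)
    qed
    obtain e where e: "e > 0" "cball c0 e \<subseteq> interior K"
      using c0 open_contains_cball[of "interior K"] by auto
    define e' where "e' = e / (norm (v' - v) + 1)"
    have n: "norm (v' - v) + 1 > 0" by (intro add_nonneg_pos) auto
    then have e': "e' > 0" using e(1) by (simp add: e'_def)
    have "norm (e' *\<^sub>R (v' - v)) \<le> e"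
      using e(1) n unfolding norm_scaleR by (simp add: e'_def field_simps)
    then have "c0 + e' *\<^sub>R (v' - v) \<in> interior K" using e(2) by (auto simp: dist_norm)
    then have "(c0 + e' *\<^sub>R (v' - v)) \<bullet> (v' - v) = 0" by (rule orth)
    then have "(v' - v) \<bullet> (v' - v) = 0" using orth[OF c0] e' by (simp add: inner_add_left)
    then show "v' = v" by simp
  qed
  then show ?thesis using vK c by simp
qed

text \<open>For the lower bound, shift \<open>u\<close> and the relaxed solution \<open>v\<close> by a large multiple of the free
  directions: the first remains in the box of optimal vectors, the second becomes nonnegative and is
  optimal for the linear program of the same fiber. For the upper bound, take an optimal \<open>u\<close> in the box
  of a component with corner \<open>u'\<close>. Adding \<open>u' - u\<close> maps the feasible points of the linear program
  into those of the relaxed program of the component, because \<open>u \<le> u'\<close> on \<open>\<tau>\<close>.\<close>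

lemma gap_eq_Max:
  assumes K: "K \<in> groebner_fan A" "interior K \<noteq> {}" and c: "c \<in> K"
  shows "gap A c = Max ((\<lambda>d. c \<bullet> component_gap A K d) ` cone_components A K)"
  unfolding gap_def
proof (rule Greatest_equality)
  note D = components_finite_nonempty[OF K]
  let ?m = "Max ((\<lambda>d. c \<bullet> component_gap A K d) ` cone_components A K)"
  obtain c0 where c0: "c0 \<in> interior K" using K(2) by blast
  have cbox: "boxes (cone_components A K) = optimal_vectors A c0"
    using components_box_decomposition[OF K(1) c0] unfolding box_decomposition_def by (elim conjE)
  have Kc0: "K = groebner_cone A c0" "c0 \<in> bounded_costs A"
    using optimal_vectors_on_cone[OF K(1) c0] by auto
  have opt: "optimal_vectors A c0 \<subseteq> optimal_vectors A c" using c Kc0 by (simp add: groebner_cone_def)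
  have cb: "c \<in> bounded_costs A" using groebner_cone_bounded[OF Kc0(2)] c Kc0(1) by blast
  have "?m \<in> (\<lambda>d. c \<bullet> component_gap A K d) ` cone_components A K" using D by (intro Max_in) auto
  then obtain u \<tau> where d: "(u, \<tau>) \<in> cone_components A K" "?m = c \<bullet> component_gap A K (u, \<tau>)" by auto
  define v where "v = relaxed_solution A K u \<tau>"
  have v: "relaxed_optimal A c u \<tau> v" unfolding v_def by (rule relaxed_solution_optimal[OF K d(1) c])
  obtain N :: nat where N: "(\<Sum>i\<in>UNIV. \<bar>v $ i\<bar>) \<le> real N" using real_arch_simple by blast
  define x where "x = v + real N *\<^sub>R rvec (free_part \<tau>)"
  define y where "y = u + N *s free_part \<tau>"
  have "y \<in> lower_box u \<tau>" by (simp add: y_def lower_box_def free_part_def)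
  then have "y \<in> optimal_vectors A c0" unfolding cbox[symmetric] using d by blast
  then have "y \<in> optimal_vectors A c" using opt by blast
  then have ip: "ip_value A c (fiber A y) = c \<bullet> rvec y" by (rule ip_value_optimal)
  have lp: "lp_value A c (fiber A y) = c \<bullet> x"
    unfolding lp_value_def
  proof (rule cInf_eq_minimum)
    have "0 \<le> x $ i" for i
    proof (cases "i \<in> \<tau>")
      case True
      then show ?thesis using v by (simp add: x_def free_part_def relaxed_optimal_def relaxed_feasible_def)
    next
      case False
      have "\<bar>v $ i\<bar> \<le> (\<Sum>i\<in>UNIV. \<bar>v $ i\<bar>)" by (rule member_le_sum) auto
      then show ?thesis using N False by (simp add: x_def free_part_def)
    qed
    moreover have "rmat A *v x = real_vec (fiber A y)"
      using v by (simp add: x_def y_def relaxed_optimal_def relaxed_feasible_def real_vec_mult[symmetric]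
        rvec_add rvec_scale matrix_vector_right_distrib)
    ultimately show "c \<bullet> x \<in> (\<lambda>u. c \<bullet> u) ` lp_feasible A (fiber A y)" by (auto simp: lp_feasible_def)
  next
    fix t assume "t \<in> (\<lambda>u. c \<bullet> u) ` lp_feasible A (fiber A y)"
    then obtain w where w: "t = c \<bullet> w" "rmat A *v w = rmat A *v rvec y" "\<forall>i. 0 \<le> w $ i"
      by (auto simp: lp_feasible_def real_vec_mult)
    have "w - real N *\<^sub>R rvec (free_part \<tau>) \<in> relaxed_feasible A u \<tau>"
      using w(2,3) by (simp add: relaxed_feasible_def y_def rvec_add rvec_scale free_part_def
        matrix_vector_right_distrib matrix_vector_mult_diff_distrib)
    then have "c \<bullet> v \<le> c \<bullet> (w - real N *\<^sub>R rvec (free_part \<tau>))"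
      using v unfolding relaxed_optimal_def by (force dest: bspec)
    then show "c \<bullet> x \<le> t" by (simp add: w(1) x_def inner_diff_right inner_add_right)
  qed
  show "\<exists>b. ip_feasible A b \<noteq> {} \<and> ip_bounded A c b \<and> ?m = ip_value A c b - lp_value A c b"
  proof (intro exI[of _ "fiber A y"] conjI)
    show "ip_feasible A (fiber A y) \<noteq> {}" by (auto simp: ip_feasible_eq)
    show "ip_bounded A c (fiber A y)" using cb by (simp add: bounded_costs_def)
    show "?m = ip_value A c (fiber A y) - lp_value A c (fiber A y)"
      unfolding ip lp d(2) by (simp add: component_gap_def v_def[symmetric] x_def y_def rvec_add rvec_scale
        inner_diff_right inner_add_right)
  qed
next
  note D = components_finite_nonempty[OF K]
  let ?m = "Max ((\<lambda>d. c \<bullet> component_gap A K d) ` cone_components A K)"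
  obtain c0 where c0: "c0 \<in> interior K" using K(2) by blast
  have cbox: "boxes (cone_components A K) = optimal_vectors A c0"
    using components_box_decomposition[OF K(1) c0] unfolding box_decomposition_def by (elim conjE)
  have Kc0: "K = groebner_cone A c0" "c0 \<in> bounded_costs A"
    using optimal_vectors_on_cone[OF K(1) c0] by auto
  have opt: "optimal_vectors A c0 \<subseteq> optimal_vectors A c" using c Kc0 by (simp add: groebner_cone_def)
  fix g assume "\<exists>b. ip_feasible A b \<noteq> {} \<and> ip_bounded A c b \<and> g = ip_value A c b - lp_value A c b"
  then obtain b where b: "ip_feasible A b \<noteq> {}" "g = ip_value A c b - lp_value A c b" by blast
  then obtain w0 where w0: "b = fiber A w0" by (auto simp: ip_feasible_eq)
  obtain u where u: "u \<in> optimal_vectors A c0" "fiber A u = b" using exists_optimal[OF Kc0(2)] w0 by blast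
  obtain u' \<tau> where d: "(u', \<tau>) \<in> cone_components A K" "u \<in> lower_box u' \<tau>"
    using u(1) unfolding cbox[symmetric] by blast
  define v where "v = relaxed_solution A K u' \<tau>"
  have v: "relaxed_optimal A c u' \<tau> v" unfolding v_def by (rule relaxed_solution_optimal[OF K d(1) c])
  have "c \<bullet> component_gap A K (u', \<tau>) \<le> ?m" using D(1) d(1) by (intro Max_ge) auto
  then have m: "c \<bullet> rvec u' - c \<bullet> v \<le> ?m" by (simp add: component_gap_def v_def inner_diff_right)
  have ip: "ip_value A c b = c \<bullet> rvec u" using ip_value_optimal[of u A c] u opt by auto
  have "c \<bullet> rvec u - ?m \<le> lp_value A c b"
    unfolding lp_value_def
  proof (rule cINF_greatest)
    have "rvec u \<in> lp_feasible A b" using u(2) by (simp add: lp_feasible_def real_vec_mult)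
    then show "lp_feasible A b \<noteq> {}" by blast
    fix y assume "y \<in> lp_feasible A b"
    then have y: "rmat A *v y = rmat A *v rvec u" "\<forall>i. 0 \<le> y $ i"
      using u(2) by (auto simp: lp_feasible_def real_vec_mult)
    have "y + (rvec u' - rvec u) \<in> relaxed_feasible A u' \<tau>"
      unfolding relaxed_feasible_def
    proof (intro CollectI conjI ballI)
      show "rmat A *v (y + (rvec u' - rvec u)) = rmat A *v rvec u'"
        using y(1) by (simp add: matrix_vector_right_distrib matrix_vector_mult_diff_distrib)
      fix i assume "i \<in> \<tau>"
      then have "u $ i \<le> u' $ i" using d(2) by (simp add: lower_box_def)
      moreover have "0 \<le> y $ i" using y(2) by simp
      ultimately show "0 \<le> (y + (rvec u' - rvec u)) $ i" by simp
    qed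
    then have "c \<bullet> v \<le> c \<bullet> (y + (rvec u' - rvec u))"
      using v unfolding relaxed_optimal_def by (force dest: bspec)
    then show "c \<bullet> rvec u - ?m \<le> c \<bullet> y" using m by (simp add: inner_add_right inner_diff_right)
  qed
  then show "g \<le> ?m" using ip b(2) by simp
qed

lemma component_gap_le:
  assumes "K \<in> groebner_fan A" "interior K \<noteq> {}" "c \<in> K" "d \<in> cone_components A K"
  shows "c \<bullet> component_gap A K d \<le> gap A c"
  unfolding gap_eq_Max[OF assms(1-3)] using assms components_finite_nonempty[OF assms(1,2)] by simp

lemma gap_attained:
  assumes "K \<in> groebner_fan A" "interior K \<noteq> {}" "c \<in> K"
  obtains d where "d \<in> cone_components A K" "gap A c = c \<bullet> component_gap A K d"
proof -
  have "gap A c \<in> (\<lambda>d. c \<bullet> component_gap A K d) ` cone_components A K"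
    unfolding gap_eq_Max[OF assms] using components_finite_nonempty[OF assms(1,2)] by (intro Max_in) auto
  then show ?thesis using that by blast
qed

lemma is_linear_on_inner: "(\<And>c. c \<in> S \<Longrightarrow> f c = c \<bullet> w) \<Longrightarrow> is_linear_on S f"
  unfolding is_linear_on_def
  by (intro exI[of _ "\<lambda>c. c \<bullet> w"]) (auto intro!: bounded_linear.linear bounded_linear_inner_left)

section \<open>Piecewise linearity and the gap fan\<close>

text \<open>The pieces are the parts of the full-dimensional cones on which a fixed component attains the gap.\<close>

lemma gap_piecewise_linear: "piecewise_linear_on (bounded_costs A) (gap A)"
  unfolding piecewise_linear_on_def
proof -
  define T where "T = {K \<in> groebner_fan A. interior K \<noteq> {}}"
  define piece where "piece K d = K \<inter> (\<Inter>d'\<in>cone_components A K.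
    {c. (component_gap A K d' - component_gap A K d) \<bullet> c \<le> 0})" for K d
  define P where "P = (\<Union>K\<in>T. piece K ` cone_components A K)"
  have T: "K \<in> groebner_fan A" "interior K \<noteq> {}" if "K \<in> T" for K using that by (auto simp: T_def)
  have mem: "c \<in> piece K d \<longleftrightarrow> c \<in> K \<and> (\<forall>d'\<in>cone_components A K. c \<bullet> component_gap A K d' \<le> c \<bullet> component_gap A K d)"
    for c K d
    by (simp add: piece_def inner_diff_left inner_commute[of "component_gap A K _"])
  have "finite T"
    using polyhedral_fan_groebner_cones[of A] unfolding T_def groebner_fan_eq polyhedral_fan_def by simp
  then have "finite P"
    unfolding P_def by (intro finite_UN_I finite_imageI components_finite_nonempty(1) T)
  moreover have "polyhedron C \<and> is_linear_on C (gap A)" if "C \<in> P" for C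
  proof -
    obtain K d where K: "K \<in> T" "d \<in> cone_components A K" "C = piece K d"
      using \<open>C \<in> P\<close> unfolding P_def by blast
    have "polyhedron K" using T(1)[OF K(1)] polyhedron_groebner_cone by (auto simp: groebner_fan_eq)
    moreover have "polyhedron (\<Inter>d'\<in>cone_components A K. {c. (component_gap A K d' - component_gap A K d) \<bullet> c \<le> 0})"
    proof (rule polyhedron_Inter)
      fix S assume "S \<in> (\<lambda>d'. {c. (component_gap A K d' - component_gap A K d) \<bullet> c \<le> 0}) ` cone_components A K"
      then obtain d' where "S = {c. (component_gap A K d' - component_gap A K d) \<bullet> c \<le> 0}" by blast
      then show "polyhedron S" by (simp only: polyhedron_halfspace_le)
    qed (use components_finite_nonempty(1)[OF T[OF K(1)]] in simp)
    ultimately have "polyhedron C" unfolding K(3) piece_def by (rule polyhedron_Int)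
    moreover have "gap A c = c \<bullet> component_gap A K d" if c: "c \<in> C" for c
    proof -
      have cK: "c \<in> K" and le: "\<forall>d'\<in>cone_components A K. c \<bullet> component_gap A K d' \<le> c \<bullet> component_gap A K d"
        using c unfolding K(3) mem by auto
      obtain d' where "d' \<in> cone_components A K" "gap A c = c \<bullet> component_gap A K d'"
        using gap_attained[OF T[OF K(1)] cK] by blast
      then show ?thesis using le component_gap_le[OF T[OF K(1)] cK K(2)] by (intro antisym) auto
    qed
    ultimately show ?thesis using is_linear_on_inner by blast
  qed
  moreover have "\<Union>P = bounded_costs A"
  proof
    show "\<Union>P \<subseteq> bounded_costs A"
    proof
      fix c assume "c \<in> \<Union>P"
      then obtain K where "K \<in> T" "c \<in> K" by (auto simp: P_def mem)
      moreover from T(1)[OF this(1)] obtain d where "d \<in> bounded_costs A" "K = groebner_cone A d"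
        unfolding groebner_fan_eq by blast
      ultimately show "c \<in> bounded_costs A" using groebner_cone_bounded by blast
    qed
    show "bounded_costs A \<subseteq> \<Union>P"
    proof
      fix c assume "c \<in> bounded_costs A"
      then obtain K where K: "K \<in> T" "c \<in> K" unfolding T_def using in_full_dimensional_cone[of c A] by blast
      obtain d where d: "d \<in> cone_components A K" "gap A c = c \<bullet> component_gap A K d"
        using gap_attained[OF T[OF K(1)] K(2)] by blast
      then have "c \<in> piece K d"
        using K(2) component_gap_le[OF T[OF K(1)] K(2)] by (simp add: mem)
      then show "c \<in> \<Union>P" using d(1) K(1) by (auto simp: P_def)
    qed
  qed
  ultimately show "\<exists>P. finite P \<and> (\<forall>C\<in>P. polyhedron C \<and> is_linear_on C (gap A)) \<and> \<Union>P = bounded_costs A"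
    by blast
qed

lemma mem_gap_polyhedron:
  "(c, t) \<in> gap_polyhedron A K \<longleftrightarrow> c \<in> K \<and> (\<forall>d\<in>cone_components A K. c \<bullet> component_gap A K d \<le> t)"
  by (auto simp: gap_polyhedron_def component_gap_def)

text \<open>The points of a face \<open>F\<close> of the lower envelope are \<open>(c, gap A c)\<close>. A component attaining the gap at a
  relative interior point of \<open>F\<close> gives a valid inequality \<open>c \<bullet> w \<le> t\<close> on \<open>F\<close> that is an equality at this
  point; prolonging a segment from any other point of \<open>F\<close> through it yields equality there too.\<close>

lemma gap_linear_on_gap_fan:
  assumes "C \<in> gap_fan A"
  shows "is_linear_on C (gap A)"
proof -
  obtain F K where F: "C = fst ` F" "K \<in> maximal_cones (groebner_fan A)" "F face_of gap_polyhedron A K"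
    "F \<noteq> {}" "F \<subseteq> lower_envelope (gap_polyhedron A K)"
    using assms unfolding gap_fan_def by blast
  note K = maximal_cone_interior[OF F(2)]
  have sub: "F \<subseteq> gap_polyhedron A K" using F(3) by (rule face_of_imp_subset)
  have t: "c \<in> K" "t = gap A c" if "(c, t) \<in> F" for c t
  proof -
    have ct: "(c, t) \<in> gap_polyhedron A K" using that sub by blast
    then show c: "c \<in> K" by (simp add: mem_gap_polyhedron)
    have "(c, gap A c) \<in> gap_polyhedron A K" using component_gap_le[OF K c] c by (simp add: mem_gap_polyhedron)
    then have "t \<le> gap A c" using that F(5) by (auto simp: lower_envelope_def)
    moreover have "gap A c \<le> t" using gap_attained[OF K c] ct by (metis mem_gap_polyhedron)
    ultimately show "t = gap A c" by simp
  qed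
  have conv: "convex F" using F(3) by (rule face_of_imp_convex)
  then obtain c1 t1 where p1: "(c1, t1) \<in> rel_interior F"
    using F(4) rel_interior_eq_empty[of F] by (metis ex_in_conv surj_pair)
  then have "(c1, t1) \<in> F" using rel_interior_subset by blast
  then have c1: "c1 \<in> K" "t1 = gap A c1" by (rule t)+
  obtain d where d: "d \<in> cone_components A K" "gap A c1 = c1 \<bullet> component_gap A K d"
    using gap_attained[OF K c1(1)] by blast
  have "gap A c = c \<bullet> component_gap A K d" if "c \<in> C" for c
  proof -
    obtain t' where ct: "(c, t') \<in> F" using \<open>c \<in> C\<close> F(1) by auto
    then have c: "c \<in> K" "t' = gap A c" by (rule t)+
    obtain e where e: "e > 1" "(1 - e) *\<^sub>R (c, t') + e *\<^sub>R (c1, t1) \<in> F"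
      using p1 ct convex_rel_interior_iff[OF conv F(4)] by blast
    then have "((1 - e) *\<^sub>R c + e *\<^sub>R c1, (1 - e) * t' + e * t1) \<in> gap_polyhedron A K" using sub by auto
    then have "((1 - e) *\<^sub>R c + e *\<^sub>R c1) \<bullet> component_gap A K d \<le> (1 - e) * t' + e * t1"
      using d(1) by (simp add: mem_gap_polyhedron)
    then have "(e - 1) * t' \<le> (e - 1) * (c \<bullet> component_gap A K d)"
      using d(2) c1(2) by (simp add: inner_add_left algebra_simps)
    then have "gap A c \<le> c \<bullet> component_gap A K d" using e(1) c(2) by simp
    then show ?thesis using component_gap_le[OF K c(1) d(1)] by simp
  qed
  then show ?thesis by (rule is_linear_on_inner)
qed

section \<open>A matrix with a nonlinear gap on a cone of its Groebner fan\<close>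

text \<open>For the cost \<open>(0, a, b)\<close> the first variable is free of charge. So if \<open>a \<le> 2 b\<close> and \<open>b \<le> 2 a\<close>, the
  linear relaxation of a feasible program has value 0 and only the right-hand side modulo 3 matters:
  residue 1 is met most cheaply by one unit of the second variable, residue 2 by one unit of the
  third.\<close>

definition example_matrix :: "int ^ 3 ^ 1" where
  "example_matrix = vector [vector [3, 1, 2]]"

definition example_cost :: "real \<Rightarrow> real \<Rightarrow> real ^ 3" where
  "example_cost a b = vector [0, a, b]"

lemma example_fiber:
  "fiber example_matrix u = fiber example_matrix w \<longleftrightarrow>
    3 * u $ 1 + u $ 2 + 2 * u $ 3 = 3 * w $ 1 + w $ 2 + 2 * w $ 3"
proof -
  have "fiber example_matrix u = fiber example_matrix w \<longleftrightarrow>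
    3 * int (u $ 1) + int (u $ 2) + 2 * int (u $ 3) = 3 * int (w $ 1) + int (w $ 2) + 2 * int (w $ 3)"
    by (simp add: vec_eq_iff forall_1 matrix_vector_mult_def sum_3 int_vec_def example_matrix_def
      vector_3 vector_def)
  then show ?thesis by linarith
qed

lemma example_value: "example_cost a b \<bullet> rvec u = a * real (u $ 2) + b * real (u $ 3)"
  by (simp add: example_cost_def inner_vec_def sum_3 vector_3)

text \<open>Modulo 3, a solution that lacks the single unit of the representative contains at least two units of
  the other variable.\<close>

lemma residue_bound:
  fixes a b :: real and x y x' y' z z' :: nat
  assumes ab: "a \<le> 2 * b" "b \<le> 2 * a" and "x' + y' \<le> 1" and eq: "3 * z + x + 2 * y = 3 * z' + x' + 2 * y'"
  shows "a * real x' + b * real y' \<le> a * real x + b * real y"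
proof -
  have pos: "0 \<le> a" "0 \<le> b" using ab by linarith+
  have mono: "a * real i + b * real j \<le> a * real x + b * real y" if "i \<le> x" "j \<le> y" for i j
    using that pos by (intro add_mono mult_left_mono) auto
  consider "x' = 0" "y' = 0" | "x' = 1" "y' = 0" | "x' = 0" "y' = 1"
    using \<open>x' + y' \<le> 1\<close> by linarith
  then show ?thesis
  proof cases
    case 1
    then show ?thesis using mono[of 0 0] by simp
  next
    case 2
    then have "x \<ge> 1 \<or> y \<ge> 2" using eq by presburger
    then show ?thesis using mono[of 1 0] mono[of 0 2] ab 2 by auto
  next
    case 3
    then have "y \<ge> 1 \<or> x \<ge> 2" using eq by presburger
    then show ?thesis using mono[of 0 1] mono[of 2 0] ab 3 by auto
  qed
qed

lemma example_optimal:
  assumes "a \<le> 2 * b" "b \<le> 2 * a" "u $ 2 + u $ 3 \<le> 1"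
  shows "u \<in> optimal_vectors example_matrix (example_cost a b)"
  unfolding optimal_iff example_fiber example_value
proof (intro allI impI)
  fix w assume "3 * w $ 1 + w $ 2 + 2 * w $ 3 = 3 * u $ 1 + u $ 2 + 2 * u $ 3"
  then show "a * real (u $ 2) + b * real (u $ 3) \<le> a * real (w $ 2) + b * real (w $ 3)"
    by (rule residue_bound[OF assms])
qed

lemma example_representative:
  obtains w where "fiber example_matrix w = fiber example_matrix u" "w $ 2 + w $ 3 \<le> 1"
proof
  define s where "s = 3 * u $ 1 + u $ 2 + 2 * u $ 3"
  define w :: "nat ^ 3" where
    "w = vector [s div 3, if s mod 3 = 1 then 1 else 0, if s mod 3 = 2 then 1 else 0]"
  have "3 * (s div 3) + (if s mod 3 = 1 then 1 else 0) + 2 * (if s mod 3 = 2 then 1 else 0) = s"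
    by presburger
  then show "fiber example_matrix w = fiber example_matrix u"
    unfolding example_fiber w_def vector_3 by (simp add: s_def)
  show "w $ 2 + w $ 3 \<le> 1" by (simp add: w_def vector_3)
qed

lemma example_cost_in_cone:
  assumes "a \<le> 2 * b" "b \<le> 2 * a"
  shows "example_cost a b \<in> groebner_cone example_matrix (example_cost 1 1)"
  unfolding groebner_cone_def
proof (intro CollectI subsetI)
  fix u assume u: "u \<in> optimal_vectors example_matrix (example_cost 1 1)"
  obtain w where w: "fiber example_matrix w = fiber example_matrix u" "w $ 2 + w $ 3 \<le> 1"
    by (rule example_representative)
  have "real (u $ 2) + real (u $ 3) \<le> real (w $ 2) + real (w $ 3)"
    using optimal_le[OF u w(1)] unfolding example_value by simp
  then have "u $ 2 + u $ 3 \<le> 1" using w(2) by linarith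
  then show "u \<in> optimal_vectors example_matrix (example_cost a b)" by (rule example_optimal[OF assms])
qed

lemma example_lp_value:
  assumes "0 \<le> a" "0 \<le> b"
  shows "lp_value example_matrix (example_cost a b) (fiber example_matrix u) = 0"
  unfolding lp_value_def
proof (rule cInf_eq_minimum)
  define x :: "real ^ 3" where
    "x = vector [(3 * real (u $ 1) + real (u $ 2) + 2 * real (u $ 3)) / 3, 0, 0]"
  have "x \<in> lp_feasible example_matrix (fiber example_matrix u)"
    by (simp add: lp_feasible_def x_def real_vec_def int_vec_def vec_eq_iff forall_1 forall_3
      matrix_vector_mult_def sum_3 vector_3 example_matrix_def map_matrix_def vector_def)
  moreover have "example_cost a b \<bullet> x = 0"
    by (simp add: example_cost_def x_def inner_vec_def sum_3 vector_3)
  ultimately show "0 \<in> (\<lambda>y. example_cost a b \<bullet> y) ` lp_feasible example_matrix (fiber example_matrix u)"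
    by (metis image_eqI)
next
  fix t assume "t \<in> (\<lambda>y. example_cost a b \<bullet> y) ` lp_feasible example_matrix (fiber example_matrix u)"
  then show "0 \<le> t" using assms
    by (auto simp: lp_feasible_def example_cost_def inner_vec_def sum_3 vector_3)
qed

lemma example_cost_bounded:
  assumes "0 \<le> a" "0 \<le> b"
  shows "example_cost a b \<in> bounded_costs A"
proof (rule nonneg_in_bounded_costs)
  show "0 \<le> example_cost a b $ i" for i
    using exhaust_3[of i] assms by (auto simp: example_cost_def vector_3)
qed

text \<open>The worst right-hand side is the one of the more expensive unit vector.\<close>

lemma example_gap:
  assumes ab: "a \<le> 2 * b" "b \<le> 2 * a"
  shows "gap example_matrix (example_cost a b) = max a b"
  unfolding gap_def
proof (rule Greatest_equality)
  have pos: "0 \<le> a" "0 \<le> b" using ab by linarith+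
  have lp: "lp_value example_matrix (example_cost a b) (fiber example_matrix u) = 0" for u
    by (rule example_lp_value[OF pos])
  define u :: "nat ^ 3" where "u = (if b \<le> a then vector [0, 1, 0] else vector [0, 0, 1])"
  have "u \<in> optimal_vectors example_matrix (example_cost a b)"
    by (rule example_optimal[OF ab]) (simp add: u_def vector_3)
  then have "ip_value example_matrix (example_cost a b) (fiber example_matrix u) = max a b"
    by (simp add: ip_value_optimal example_value u_def vector_3)
  moreover have "example_cost a b \<in> bounded_costs example_matrix"
    by (rule example_cost_bounded[OF pos])
  ultimately show "\<exists>b'. ip_feasible example_matrix b' \<noteq> {} \<and> ip_bounded example_matrix (example_cost a b) b' \<and>
      max a b = ip_value example_matrix (example_cost a b) b' - lp_value example_matrix (example_cost a b) b'"
    using lp[of u] by (intro exI[of _ "fiber example_matrix u"]) (auto simp: ip_feasible_eq bounded_costs_def)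
next
  have pos: "0 \<le> a" "0 \<le> b" using ab by linarith+
  fix g assume "\<exists>b'. ip_feasible example_matrix b' \<noteq> {} \<and> ip_bounded example_matrix (example_cost a b) b' \<and>
      g = ip_value example_matrix (example_cost a b) b' - lp_value example_matrix (example_cost a b) b'"
  then obtain u where g: "g = ip_value example_matrix (example_cost a b) (fiber example_matrix u) -
      lp_value example_matrix (example_cost a b) (fiber example_matrix u)"
    by (auto simp: ip_feasible_eq)
  obtain w where w: "fiber example_matrix w = fiber example_matrix u" "w $ 2 + w $ 3 \<le> 1"
    by (rule example_representative)
  have "g = a * real (w $ 2) + b * real (w $ 3)"
    using ip_value_optimal[OF example_optimal[OF ab w(2)]] w(1) g
    by (simp add: example_value example_lp_value[OF pos])
  also have "\<dots> \<le> max a b * real (w $ 2) + max a b * real (w $ 3)"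
    by (intro add_mono mult_right_mono) auto
  also have "\<dots> = max a b * real (w $ 2 + w $ 3)" by (simp add: algebra_simps)
  also have "\<dots> \<le> max a b * 1" using w(2) pos by (intro mult_left_mono) auto
  finally show "g \<le> max a b" by simp
qed

text \<open>The costs \<open>(0, 1, 2)\<close> and \<open>(0, 2, 1)\<close> lie on the boundary of the cone and have gap 2, but their sum
  \<open>(0, 3, 3)\<close> has gap 3.\<close>

lemma example_not_linear:
  "\<not> is_linear_on (groebner_cone example_matrix (example_cost 1 1)) (gap example_matrix)"
proof
  assume "is_linear_on (groebner_cone example_matrix (example_cost 1 1)) (gap example_matrix)"
  then obtain L where L: "linear L"
    "\<And>c. c \<in> groebner_cone example_matrix (example_cost 1 1) \<Longrightarrow> gap example_matrix c = L c"
    unfolding is_linear_on_def by blast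
  have max: "L (example_cost a b) = max a b" if "a \<le> 2 * b" "b \<le> 2 * a" for a b
    using L(2)[OF example_cost_in_cone[OF that]] example_gap[OF that] by simp
  have "example_cost 3 3 = example_cost 1 2 + example_cost 2 1"
    by (simp add: example_cost_def vec_eq_iff forall_3 vector_3)
  then have "L (example_cost 3 3) = L (example_cost 1 2) + L (example_cost 2 1)"
    by (simp add: linear_add[OF L(1)])
  then show False using max[of 3 3] max[of 1 2] max[of 2 1] by simp
qed

lemma example_cone_in_groebner_fan:
  "groebner_cone example_matrix (example_cost 1 1) \<in> groebner_fan example_matrix"
proof -
  show ?thesis unfolding groebner_fan_eq by (intro imageI example_cost_bounded) simp_all
qed

theorem corollary5p2:
  fixes A :: "int ^ 'n ^ 'd"
  shows "piecewise_linear_on (bounded_costs A) (gap A)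
    \<and> (\<forall>C\<in>gap_fan A. is_linear_on C (gap A))
    \<and> (\<exists>B :: int ^ 3 ^ 1. \<exists>K\<in>groebner_fan B. \<not> is_linear_on K (gap B))"
  using gap_piecewise_linear gap_linear_on_gap_fan example_cone_in_groebner_fan example_not_linear
  by blast

end
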